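(* Let $a_1,\dots,a_n$ be positive integers with $\gcd(a_1,\dots,a_n)=1$ whose sum $m$ is not a power of two, and let $P=(p_1,\dots,p_n)$ with $p_i=a_i/m$. Write $m=2^u x$ with $x>1$ odd and $u\ge0$, and let $\ell$ be the multiplicative order of $2$ modulo $x$. Let $q_i=c\,a_i/2^{u+\ell}$ where $c=\lfloor 2^{u+\ell}/m\rfloor$. The following are equivalent: (1) for some integer $K$ with $\lceil\log m\rceil\le K\le u+\ell$, the tree $\mathrm{ALDR}[P,K]$ is entropy optimal; (2) $\mathrm{ALDR}[P,u+\ell]$ is entropy optimal; (3) for all $1\le i\le n$, $(1-z^\ell)\sum_d \epsilon_d(p_i)z^d=\sum_d\epsilon_d(q_i)z^d$ as formal power series; (4) for all $1\le i\le n$, the formal power series $(1-z^\ell)\sum_d\epsilon_d(p_i)z^d$ has only nonnegative coefficients; (5) for all $d\ge1$ and $1\le i\le n$, $\epsilon_d(p_i)\le\epsilon_{d+\ell}(p_i)$.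
   Context: All logarithms are base 2. For real $x\ge0$ and integer $d$, $\epsilon_d(x)=\lfloor2^dx\rfloor\bmod2$ (the $d$th binary digit after the point for $x\in[0,1)$), and $\nu(x)=\sum_d d\,\epsilon_d(x)2^{-d}$. A DDG tree is a sampler driven by i.i.d. fair bits: a binary tree (possibly with back edges to the root) with labeled leaves traversed from the root one fair bit per step until a leaf is reached, whose label is output. A DDG tree with output distribution $P$ is entropy optimal if its expected number of consumed bits is minimal among all DDG trees with output distribution $P$; equivalently, after unrolling all back edges, it has exactly $\epsilon_d(p_i)$ leaves labeled $i$ at depth $d$ for every $i$ and $d$. FLDR: for positive integers $A_1,\dots,A_n$ with sum $M$, $K'=\lceil\log M\rceil$, $A_0=2^{K'}-M$, $Q=(A_0/2^{K'},\dots,A_n/2^{K'})$; $\mathrm{FLDR}[A_1,\dots,A_n]$ is an entropy-optimal DDG tree for $Q$ (exactly $\epsilon_d(A_i/2^{K'})$ leaves labeled $i$ at depth $d$) with every leaf labeled $0$ replaced by a back edge to the root; its output distribution is $(A_i/M)$. For integer $K\ge\lceil\log m\rceil$, $c_K=\lfloor2^K/m\rfloor$ and $\mathrm{ALDR}[P,K]=\mathrm{FLDR}[c_Ka_1,\dots,c_Ka_n]$. *)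

theory Defs
  imports "HOL-Probability.Probability" "HOL-Number_Theory.Number_Theory"
    "HOL-Computational_Algebra.Formal_Power_Series"
begin

subsection \<open>Binary digits\<close>

definition eps :: "int \<Rightarrow> real \<Rightarrow> int" where
  "eps d x = \<lfloor>2 powi d * x\<rfloor> mod 2"

text \<open>For \<open>x \<in> [0,1)\<close> all digits with index \<open>d \<le> 0\<close> vanish, so nothing is lost by summing over
  \<open>d \<ge> 0\<close> only.\<close>

definition digit_fps :: "real \<Rightarrow> int fps" where
  "digit_fps x = Abs_fps (\<lambda>d. eps (int d) x)"

subsection \<open>DDG trees\<close>

text \<open>Trees may be infinite. An occurrence of \<open>Back\<close> is not a node of its own: an edge leading to it
  is an edge leading back to the root.\<close>

codatatype 'a ddg = Leaf 'a | Node "'a ddg" "'a ddg" | Back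

primrec node_at :: "'a ddg \<Rightarrow> bool list \<Rightarrow> 'a ddg option" where
  "node_at t [] = Some t"
| "node_at t (b # bs) = (case t of Node l r \<Rightarrow> node_at (if b then r else l) bs | _ \<Rightarrow> None)"

definition leaf_count :: "'a ddg \<Rightarrow> nat \<Rightarrow> 'a \<Rightarrow> nat" where
  "leaf_count t d i = card {w. length w = d \<and> node_at t w = Some (Leaf i)}"

text \<open>\<open>unroll_from r t\<close> replaces every back edge in \<open>t\<close> by a fresh unrolled copy of \<open>r\<close>.
  Following a back edge consumes no bit.\<close>

primcorec unroll_from :: "'a ddg \<Rightarrow> 'a ddg \<Rightarrow> 'a ddg" where
  "unroll_from r t =
    (case (if t = Back then r else t) of
       Leaf a \<Rightarrow> Leaf a
     | Node t1 t2 \<Rightarrow> Node (unroll_from r t1) (unroll_from r t2)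
     | Back \<Rightarrow> Back)"

definition unroll :: "'a ddg \<Rightarrow> 'a ddg" where
  "unroll t = unroll_from t t"

definition fair_bits :: "bool stream measure" where
  "fair_bits = stream_space (measure_pmf (bernoulli_pmf (1/2)))"

definition outputs :: "'a ddg \<Rightarrow> bool stream \<Rightarrow> 'a \<Rightarrow> bool" where
  "outputs t \<omega> i \<longleftrightarrow> (\<exists>k. node_at (unroll t) (stake k \<omega>) = Some (Leaf i))"

text \<open>The infimum of the empty set is \<open>\<infinity>\<close>, the value for a run that never reaches a leaf.\<close>

definition bits_consumed :: "'a ddg \<Rightarrow> bool stream \<Rightarrow> enat" where
  "bits_consumed t \<omega> = Inf {enat k | k. \<exists>i. node_at (unroll t) (stake k \<omega>) = Some (Leaf i)}"

definition expected_bits :: "'a ddg \<Rightarrow> ennreal" where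
  "expected_bits t = (\<integral>\<^sup>+ \<omega>. ennreal_of_enat (bits_consumed t \<omega>) \<partial>fair_bits)"

definition has_output_distribution :: "'a ddg \<Rightarrow> ('a \<Rightarrow> real) \<Rightarrow> bool" where
  "has_output_distribution t P \<longleftrightarrow> (\<forall>i. measure fair_bits {\<omega>. outputs t \<omega> i} = P i)"

definition entropy_optimal :: "('a \<Rightarrow> real) \<Rightarrow> 'a ddg \<Rightarrow> bool" where
  "entropy_optimal P t \<longleftrightarrow> has_output_distribution t P \<and>
     (\<forall>t'. has_output_distribution t' P \<longrightarrow> expected_bits t \<le> expected_bits t')"

subsection \<open>FLDR and ALDR\<close>

primcorec reject :: "'a \<Rightarrow> 'a ddg \<Rightarrow> 'a ddg" where
  "reject z t =
    (case t of
       Leaf a \<Rightarrow> if a = z then Back else Leaf a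
     | Node t1 t2 \<Rightarrow> Node (reject z t1) (reject z t2)
     | Back \<Rightarrow> Back)"

text \<open>Weights \<open>A 1, \<dots>, A n\<close> are given by a function on \<open>{1..n}\<close>; its other values, in particular
  \<open>A 0\<close>, are ignored.\<close>

definition fldr_depth :: "nat \<Rightarrow> (nat \<Rightarrow> nat) \<Rightarrow> nat" where
  "fldr_depth n A = nat \<lceil>log 2 (real (\<Sum>i=1..n. A i))\<rceil>"

definition fldr_proposal :: "nat \<Rightarrow> (nat \<Rightarrow> nat) \<Rightarrow> nat \<Rightarrow> real" where
  "fldr_proposal n A i =
    (if i = 0 then real (2 ^ fldr_depth n A - (\<Sum>j=1..n. A j)) / 2 ^ fldr_depth n A
     else if i \<le> n then real (A i) / 2 ^ fldr_depth n A
     else 0)"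

text \<open>The tree is only determined up to the arrangement of the leaves within each level, so FLDR is a
  predicate on trees. The proposal probabilities sum to 1, hence the leaf counts force \<open>t0\<close> to be
  free of back edges.\<close>

definition is_FLDR :: "nat \<Rightarrow> (nat \<Rightarrow> nat) \<Rightarrow> nat ddg \<Rightarrow> bool" where
  "is_FLDR n A t \<longleftrightarrow>
    (\<exists>t0. (\<forall>d i. int (leaf_count t0 d i) = eps (int d) (fldr_proposal n A i)) \<and> t = reject 0 t0)"

definition is_ALDR :: "nat \<Rightarrow> (nat \<Rightarrow> nat) \<Rightarrow> nat \<Rightarrow> nat ddg \<Rightarrow> bool" where
  "is_ALDR n a K t \<longleftrightarrow> is_FLDR n (\<lambda>i. (2 ^ K div (\<Sum>j=1..n. a j)) * a i) t"

subsection \<open>Equivalence of several statements\<close>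

definition all_equivalent :: "bool list \<Rightarrow> bool" where
  "all_equivalent Ps \<longleftrightarrow> (\<forall>P\<in>set Ps. \<forall>Q\<in>set Ps. P \<longleftrightarrow> Q)"

subsection \<open>FLDR and ALDR trees exist\<close>

lemma leaf_count_0:
  "leaf_count t 0 i = (if t = Leaf i then 1 else 0)"
proof -
  have "{w. length w = 0 \<and> node_at t w = Some (Leaf i)} = (if t = Leaf i then {[]} else {})"
    by auto
  then show ?thesis by (simp add: leaf_count_def)
qed

lemma leaf_count_Leaf_Suc: "leaf_count (Leaf j) (Suc d) i = 0"
proof -
  have "{w. length w = Suc d \<and> node_at (Leaf j) w = Some (Leaf i)} = {}"
    by (auto simp: length_Suc_conv)
  then show ?thesis unfolding leaf_count_def by (simp only: card.empty)
qed

lemma leaf_count_Node_Suc: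
  "leaf_count (Node l r) (Suc d) i = leaf_count l d i + leaf_count r d i"
proof -
  let ?S = "\<lambda>t. {w. length w = d \<and> node_at t w = Some (Leaf i)}"
  have fin: "finite (?S t)" for t :: "'a ddg"
    by (rule finite_subset[OF _ finite_lists_length_eq[OF finite, of UNIV d]]) auto
  have "{w. length w = Suc d \<and> node_at (Node l r) w = Some (Leaf i)}
      = (#) False ` ?S l \<union> (#) True ` ?S r"
    by (auto simp: length_Suc_conv split: if_splits)
  moreover have "card ((#) False ` ?S l \<union> (#) True ` ?S r) = card (?S l) + card (?S r)"
    by (subst card_Un_disjoint) (auto simp: fin card_image)
  ultimately show ?thesis by (simp add: leaf_count_def)
qed

lemma ex_paired_forest:
  "length ts = 2 * k \<Longrightarrow> \<exists>us. length us = k \<and> (\<forall>u\<in>set us. \<exists>l r. u = Node l r) \<and>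
     (\<forall>d i. (\<Sum>u\<leftarrow>us. leaf_count u (Suc d) i) = (\<Sum>t\<leftarrow>ts. leaf_count t d i))"
proof (induction k arbitrary: ts)
  case 0
  then show ?case by simp
next
  case (Suc k)
  then obtain l r ts' where ts: "ts = l # r # ts'" "length ts' = 2 * k"
    by (metis (no_types, lifting) add_2_eq_Suc length_Suc_conv mult_Suc_right)
  from Suc.IH[OF ts(2)] obtain us where
    us: "length us = k" "\<forall>u\<in>set us. \<exists>l r. u = Node l r"
      "\<forall>d i. (\<Sum>u\<leftarrow>us. leaf_count u (Suc d) i) = (\<Sum>t\<leftarrow>ts'. leaf_count t d i)"
    by blast
  show ?case
    by (rule exI[of _ "Node l r # us"]) (use us in \<open>auto simp: ts leaf_count_Node_Suc\<close>)
qed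

lemma ex_tree_with_leaves:
  fixes L :: "nat \<Rightarrow> 'a list"
  assumes "length ts + (\<Sum>d<K. length (L d) * 2 ^ (K - d)) = 2 ^ K"
  shows "\<exists>t. \<forall>d i. leaf_count t d i =
    (if d < K then count_list (L d) i else (\<Sum>u\<leftarrow>ts. leaf_count u (d - K) i))"
  using assms
proof (induction K arbitrary: ts)
  case 0
  then obtain t where "ts = [t]" by (auto simp: length_Suc_conv)
  then show ?case by auto
next
  case (Suc K)
  have *: "(\<Sum>d<K. length (L d) * 2 ^ (Suc K - d)) = 2 * (\<Sum>d<K. length (L d) * 2 ^ (K - d))"
    unfolding sum_distrib_left by (rule sum.cong) (auto simp: Suc_diff_le)
  have eq: "length ts + 2 * (\<Sum>d<K. length (L d) * 2 ^ (K - d)) + 2 * length (L K) = 2 * 2 ^ K"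
    using Suc.prems * by simp
  then have "even (length ts)" by presburger
  then obtain k where k: "length ts = 2 * k" by (elim evenE)
  from ex_paired_forest[OF k] obtain us where
    us: "length us = k" "\<forall>u\<in>set us. \<exists>l r. u = Node l r"
      "\<forall>d i. (\<Sum>u\<leftarrow>us. leaf_count u (Suc d) i) = (\<Sum>t\<leftarrow>ts. leaf_count t d i)"
    by blast
  have "length (map Leaf (L K) @ us) + (\<Sum>d<K. length (L d) * 2 ^ (K - d)) = 2 ^ K"
    using eq k us(1) by simp
  from Suc.IH[OF this] obtain t where t: "\<And>d i. leaf_count t d i =
    (if d < K then count_list (L d) i
     else (\<Sum>u\<leftarrow>map Leaf (L K) @ us. leaf_count u (d - K) i))" by blast
  have us0: "(\<Sum>u\<leftarrow>us. leaf_count u 0 i) = 0" for i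
    using us(2) by (auto simp: leaf_count_0 intro!: sum_list_0)
  have L0: "(\<Sum>j\<leftarrow>xs. leaf_count (Leaf j) 0 i) = count_list xs i" for xs and i :: 'a
    by (induction xs) (auto simp: leaf_count_0)
  have LS: "(\<Sum>j\<leftarrow>xs. leaf_count (Leaf j) (Suc d) i) = 0" for xs d and i :: 'a
    by (induction xs) (auto simp: leaf_count_Leaf_Suc)
  show ?case
  proof (intro exI[of _ t] allI)
    fix d i
    consider "d < K" | "d = K" | e where "d = Suc K + e"
      by (metis Suc_leI le_Suc_ex linorder_neqE_nat)
    then show "leaf_count t d i =
      (if d < Suc K then count_list (L d) i else (\<Sum>u\<leftarrow>ts. leaf_count u (d - Suc K) i))"
    proof cases
      case 3
      then have "d - K = Suc e" by simp
      with 3 show ?thesis using us(3) by (simp add: t LS comp_def)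
    qed (simp_all add: t us0 L0 comp_def)
  qed
qed

lemma eps_dyadic:
  "eps (int d) (real N / 2 ^ K) = (if d \<le> K then int (N div 2 ^ (K - d) mod 2) else 0)"
proof (cases "d \<le> K")
  case True
  then have "2 ^ d * (real N / 2 ^ K) = real N / real (2 ^ (K - d))"
    by (auto simp: le_iff_add power_add)
  moreover have "\<lfloor>real N / real (2 ^ (K - d))\<rfloor> = int (N div 2 ^ (K - d))"
    by (rule floor_divide_of_nat_eq)
  ultimately show ?thesis
    using True by (simp add: eps_def power_int_def zmod_int)
next
  case False
  then obtain e where e: "d = Suc (K + e)"
    by (metis less_iff_Suc_add not_le)
  have "2 ^ d * (real N / 2 ^ K) = of_int (2 * (2 ^ e * int N))"
    by (simp add: e power_add)
  then have "\<lfloor>2 ^ d * (real N / 2 ^ K)\<rfloor> = 2 * (2 ^ e * int N)"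
    by (simp only: floor_of_int)
  then show ?thesis using False by (simp add: eps_def power_int_def)
qed

lemma sum_bits:
  fixes N :: nat
  shows "(\<Sum>d<Suc K. (N div 2 ^ (K - d) mod 2) * 2 ^ (Suc K - d)) = 2 * (N mod 2 ^ Suc K)"
proof -
  have "(\<Sum>d<k. (N div 2 ^ d mod 2) * 2 ^ Suc d) = 2 * (N mod 2 ^ k)" for k
  proof (induction k)
    case (Suc k)
    have "N mod 2 ^ Suc k = 2 ^ k * (N div 2 ^ k mod 2) + N mod 2 ^ k"
      by (metis mod_mult2_eq power_Suc2)
    with Suc show ?case by simp
  qed simp
  from this[of "Suc K"] show ?thesis
    by (subst (asm) sum.nat_diff_reindex[symmetric])
      (simp add: Suc_diff_le cong: sum.cong_simp)
qed

lemma le_power2_of_log_le: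
  assumes "0 < (m :: nat)" and "log 2 (real m) \<le> real K"
  shows "m \<le> 2 ^ K"
proof -
  have "real m \<le> 2 powr real K"
    using assms by (simp add: log_le_iff)
  then have "real m \<le> real (2 ^ K)"
    by (simp add: powr_realpow)
  then show ?thesis by (simp only: of_nat_le_iff)
qed

lemma ex_is_FLDR:
  assumes "0 < (\<Sum>i=1..n. A i)"
  shows "\<exists>t. is_FLDR n A t"
proof -
  define M where "M = (\<Sum>i=1..n. A i)"
  define K where "K = fldr_depth n A"
  define B where "B i = (if i = 0 then 2 ^ K - M else if i \<le> n then A i else 0)" for i
  define L where "L d = filter (\<lambda>i. odd (B i div 2 ^ (K - d))) [0..<Suc n]" for d
  have "log 2 (real M) \<le> real K"
    by (simp add: K_def M_def fldr_depth_def) linarith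
  then have MK: "M \<le> 2 ^ K"
    using assms by (intro le_power2_of_log_le) (simp_all only: M_def)
  have sumB: "(\<Sum>i<Suc n. B i) = 2 ^ K"
  proof -
    have "(\<Sum>i<Suc n. B i) = B 0 + (\<Sum>i=1..n. B i)"
      unfolding lessThan_Suc_atMost atMost_atLeast0
      by (subst sum.atLeast_Suc_atMost) auto
    also have "(\<Sum>i=1..n. B i) = M"
      unfolding M_def by (rule sum.cong) (auto simp: B_def)
    finally show ?thesis using MK by (simp add: B_def)
  qed
  have Ble: "B i \<le> 2 ^ K" if "i < Suc n" for i
    using member_le_sum[of i "{..<Suc n}" B] that sumB by simp
  have len: "length (L d) = (\<Sum>i<Suc n. B i div 2 ^ (K - d) mod 2)" for d
  proof -
    have length_filter: "length (filter (\<lambda>i. odd (B i div 2 ^ (K - d))) xs)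
        = (\<Sum>i\<leftarrow>xs. B i div 2 ^ (K - d) mod 2)" for xs
      by (induction xs) (auto simp: odd_iff_mod_2_eq_one)
    have "length (L d) = (\<Sum>i\<leftarrow>[0..<Suc n]. B i div 2 ^ (K - d) mod 2)"
      unfolding L_def by (rule length_filter)
    then show ?thesis
      by (simp add: interv_sum_list_conv_sum_set_nat atLeast0LessThan)
  qed
  have "(\<Sum>d<Suc K. length (L d) * 2 ^ (Suc K - d))
      = (\<Sum>i<Suc n. \<Sum>d<Suc K. (B i div 2 ^ (K - d) mod 2) * 2 ^ (Suc K - d))"
    unfolding len sum_distrib_right by (rule sum.swap)
  also have "\<dots> = (\<Sum>i<Suc n. 2 * B i)"
  proof (rule sum.cong[OF refl])
    fix i assume "i \<in> {..<Suc n}"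
    then have "B i < 2 ^ Suc K" using Ble[of i] by (simp add: le_less_trans)
    then show "(\<Sum>d<Suc K. (B i div 2 ^ (K - d) mod 2) * 2 ^ (Suc K - d)) = 2 * B i"
      unfolding sum_bits by simp
  qed
  also have "\<dots> = 2 ^ Suc K" using sumB by (simp flip: sum_distrib_left)
  finally have "length ([] :: nat ddg list) + (\<Sum>d<Suc K. length (L d) * 2 ^ (Suc K - d)) = 2 ^ Suc K"
    by simp
  from ex_tree_with_leaves[OF this]
  have "\<exists>t0. \<forall>d i. leaf_count t0 d i = (if d < Suc K then count_list (L d) i else 0)"
    by (simp only: list.map sum_list.Nil)
  then obtain t0 where
    t0: "\<And>d i. leaf_count t0 d i = (if d < Suc K then count_list (L d) i else 0)"
    by blast
  have cnt: "count_list (L d) i = B i div 2 ^ (K - d) mod 2" for d i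
  proof -
    have "distinct xs \<Longrightarrow> count_list xs i = (if i \<in> set xs then 1 else 0)" for xs
      by (induction xs) auto
    then have "count_list (L d) i = (if i \<in> set (L d) then 1 else 0)"
      by (simp add: L_def)
    also have "\<dots> = B i div 2 ^ (K - d) mod 2"
      by (auto simp: L_def B_def odd_iff_mod_2_eq_one)
    finally show ?thesis .
  qed
  have proposal: "fldr_proposal n A i = real (B i) / 2 ^ K" for i
    by (simp add: fldr_proposal_def B_def M_def K_def)
  have "int (leaf_count t0 d i) = eps (int d) (fldr_proposal n A i)" for d i
    unfolding proposal eps_dyadic t0 cnt by simp
  then show ?thesis unfolding is_FLDR_def by blast
qed

lemma ex_is_ALDR:
  assumes "0 < (\<Sum>i=1..n. a i)" and "\<lceil>log 2 (real (\<Sum>i=1..n. a i))\<rceil> \<le> int K"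
  shows "\<exists>t. is_ALDR n a K t"
proof -
  let ?m = "\<Sum>i=1..n. a i"
  have "log 2 (real ?m) \<le> real K" using assms(2) by linarith
  then have "?m \<le> 2 ^ K"
    using assms(1) by (intro le_power2_of_log_le)
  then have "0 < (2 ^ K div ?m) * ?m"
    using assms(1) by (simp add: div_greater_zero_iff)
  then have "0 < (\<Sum>i=1..n. (2 ^ K div ?m) * a i)"
    by (simp only: sum_distrib_left)
  then show ?thesis unfolding is_ALDR_def by (rule ex_is_FLDR)
qed

end

theory Submission
  imports Defs
begin

text \<open>
  If \<open>c\<^sub>i(d)\<close> counts the leaves labelled \<open>i\<close> at depth \<open>d\<close> of an unrolled tree, the expected number
  of bits is \<open>\<Sum>k. (1 - \<Sum>i. \<Sum>d\<le>k. c\<^sub>i(d) / 2^d)\<close>. The inner sum over \<open>d\<close> is a multiple of \<open>1 / 2^k\<close>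
  and at most \<open>p\<^sub>i\<close>, hence at most the truncation of \<open>p\<^sub>i\<close> to \<open>k\<close> binary digits. So a tree is optimal
  iff its leaf counts are the binary digits of the \<open>p\<^sub>i\<close> (Knuth and Yao), because a tree with these
  counts exists.

  Unrolling the back edges of ALDR divides the generating function of the leaves by \<open>1 - G\<close>, where
  \<open>G\<close> is the generating function of the digits of \<open>(2^K mod m) / 2^K\<close>; for \<open>K = u + l\<close> this is \<open>z^l\<close>.
  If the unrolled counts are digits, then \<open>G\<close> has a single term: two terms would create a
  coefficient 2. Then \<open>2^K mod m\<close> is a power of two, and divisibility by \<open>m\<close> forces \<open>K \<ge> u + l\<close>.
  Finally, \<open>q\<^sub>i = p\<^sub>i - p\<^sub>i / 2^l\<close>, and the last condition says that this subtraction needs no borrow,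
  so it acts digit by digit.
\<close>

section \<open>Binary digits\<close>

definition binary_trunc :: "nat \<Rightarrow> real \<Rightarrow> real" where
  "binary_trunc k x = of_int \<lfloor>2 ^ k * x\<rfloor> / 2 ^ k"

lemma eps_cases: "eps d x = 0 \<or> eps d x = 1"
  unfolding eps_def by presburger

lemma eps_nonneg [simp]: "0 \<le> eps d x"
  by (simp add: eps_def)

lemma eps_le_1 [simp]: "eps d x \<le> 1"
  using eps_cases[of d x] by auto

lemma digit_fps_nth [simp]: "fps_nth (digit_fps x) d = eps (int d) x"
  by (simp add: digit_fps_def)

lemma digit_fps_0 [simp]: "digit_fps 0 = 0"
  by (rule fps_ext) (simp add: eps_def)

lemma eps_powi_mult: "eps d (2 powi k * x) = eps (d + k) x"
  by (simp add: eps_def power_int_add mult.assoc)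

lemma eps_div_power2: "eps d (x / 2 ^ l) = eps (d - int l) x"
  using eps_powi_mult[of d "- int l" x]
  by (simp add: power_int_minus divide_inverse mult.commute)

lemma eps_nonpos_index:
  assumes "0 \<le> x" "x < 1" "d \<le> 0"
  shows "eps d x = 0"
proof -
  have "2 powi d \<le> (1 :: real)"
    using power_int_increasing[of d 0 "2 :: real"] assms(3) by simp
  then have "2 powi d * x < 1"
    using assms(1,2) mult_left_le_one_le[of x "2 powi d"] by simp
  then have "\<lfloor>2 powi d * x\<rfloor> = 0"
    using assms(1) by (simp add: floor_eq_iff)
  then show ?thesis by (simp add: eps_def)
qed

lemma floor_power2_Suc: "\<lfloor>2 ^ Suc d * x\<rfloor> = 2 * \<lfloor>2 ^ d * x\<rfloor> + eps (int (Suc d)) x"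
proof -
  have "\<lfloor>2 ^ Suc d * x\<rfloor> div 2 = \<lfloor>2 ^ d * x\<rfloor>"
    using floor_divide_real_eq_div[of 2 "2 ^ Suc d * x"] by (simp add: mult.assoc)
  then show ?thesis
    unfolding eps_def power_int_of_nat by (metis mult_div_mod_eq)
qed

lemma binary_trunc_Suc:
  "binary_trunc (Suc k) x = binary_trunc k x + of_int (eps (int (Suc k)) x) / 2 ^ Suc k"
  unfolding binary_trunc_def floor_power2_Suc by (simp add: add_divide_distrib)

lemma sum_eps_eq_binary_trunc:
  assumes "0 \<le> x" "x < 2"
  shows "(\<Sum>d\<le>k. of_int (eps (int d) x) / 2 ^ d) = binary_trunc k x"
proof (induction k)
  case 0
  show ?case using assms by (simp add: binary_trunc_def eps_def)
next
  case (Suc k)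
  then show ?case by (simp only: sum.atMost_Suc binary_trunc_Suc)
qed

lemma binary_trunc_le: "binary_trunc k x \<le> x"
  unfolding binary_trunc_def by (simp add: divide_le_eq mult.commute)

lemma diff_binary_trunc_le: "x - binary_trunc k x \<le> (1/2) ^ k"
proof -
  have "2 ^ k * x - of_int \<lfloor>2 ^ k * x\<rfloor> \<le> 1" by linarith
  then have "(2 ^ k * x - of_int \<lfloor>2 ^ k * x\<rfloor>) / 2 ^ k \<le> 1 / 2 ^ k"
    by (rule divide_right_mono) simp
  then show ?thesis
    by (simp add: binary_trunc_def diff_divide_distrib power_one_over)
qed

lemma binary_trunc_tendsto: "(\<lambda>k. binary_trunc k x) \<longlonglongrightarrow> x"
proof (rule tendsto_sandwich)
  show "\<forall>\<^sub>F k in sequentially. x - (1/2) ^ k \<le> binary_trunc k x"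
    using diff_binary_trunc_le[of x] by (simp add: diff_le_eq add.commute)
  show "\<forall>\<^sub>F k in sequentially. binary_trunc k x \<le> x"
    by (simp add: binary_trunc_le)
  show "(\<lambda>k. x - (1/2) ^ k) \<longlonglongrightarrow> x"
    using tendsto_diff[OF tendsto_const LIMSEQ_power_zero[of "1/2 :: real"], of x] by simp
qed simp

lemma eps_sums:
  assumes "0 \<le> x" "x < 2"
  shows "(\<lambda>d. of_int (eps (int d) x) / 2 ^ d) sums x"
  unfolding sums_def_le sum_eps_eq_binary_trunc[OF assms] by (rule binary_trunc_tendsto)

lemma digit_fps_nonzero:
  assumes "0 < x" "x < 2"
  shows "digit_fps x \<noteq> 0"
proof
  assume "digit_fps x = 0"
  then have "eps (int d) x = 0" for d
    by (metis digit_fps_nth fps_zero_nth)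
  then have "(\<lambda>d. 0 :: real) sums x" using eps_sums[of x] assms by simp
  then show False using assms by (simp add: sums_iff)
qed

lemma inverse_power2_of_single_digit:
  assumes "0 < x" "x < 2"
    and unique: "\<And>j k. eps (int j) x = 1 \<Longrightarrow> eps (int k) x = 1 \<Longrightarrow> j = k"
  shows "\<exists>k. x = 1 / 2 ^ k"
proof -
  obtain k where "eps (int k) x \<noteq> 0"
    using digit_fps_nonzero[OF assms(1,2)] by (metis digit_fps_nth fps_ext fps_zero_nth)
  then have "eps (int k) x = 1" using eps_cases by blast
  then have "eps (int d) x = of_bool (d = k)" for d
    using unique eps_cases[of "int d" x] by (cases "d = k") (simp, fastforce)
  then have "(\<lambda>d. if d = k then 1 / 2 ^ d else 0) = (\<lambda>d. of_int (eps (int d) x) / 2 ^ d :: real)"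
    by auto
  then have "(\<lambda>d. if d = k then 1 / 2 ^ d else 0) sums x"
    using eps_sums[of x] assms by simp
  then have "x = 1 / 2 ^ k"
    by (rule sums_unique2[OF _ sums_single[of k "\<lambda>d. 1 / 2 ^ d"]])
  then show ?thesis ..
qed

lemma digit_fps_inverse_power2: "digit_fps (1 / 2 ^ l) = fps_X ^ l"
proof (rule fps_ext)
  fix d show "fps_nth (digit_fps (1 / 2 ^ l)) d = fps_nth (fps_X ^ l) d"
  proof (cases "d < l")
    case True
    then have "(1 :: nat) < 2 ^ (l - d)" by (intro one_less_power) simp_all
    then show ?thesis using True eps_dyadic[of d 1 l] by simp
  next
    case False
    then show ?thesis using eps_dyadic[of d 1 l] by (cases "d = l") simp_all
  qed
qed

text \<open>Each partial sum is a multiple of \<open>1 / 2 ^ k\<close>, so among all expansions with natural digits the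
  binary one has the largest partial sums.\<close>

lemma sum_le_binary_trunc:
  fixes c :: "nat \<Rightarrow> nat"
  assumes "(\<lambda>d. real (c d) / 2 ^ d) sums x"
  shows "(\<Sum>d\<le>k. real (c d) / 2 ^ d) \<le> binary_trunc k x"
proof -
  define N where "N = (\<Sum>d\<le>k. c d * 2 ^ (k - d))"
  have "2 ^ k * (\<Sum>d\<le>k. real (c d) / 2 ^ d) = real N"
    unfolding N_def sum_distrib_left of_nat_sum
    by (rule sum.cong) (auto simp: le_iff_add power_add)
  then have partial_sum: "(\<Sum>d\<le>k. real (c d) / 2 ^ d) = real N / 2 ^ k"
    by (simp add: field_simps)
  have "(\<Sum>d\<le>k. real (c d) / 2 ^ d) \<le> x"
    using sum_le_suminf[of "\<lambda>d. real (c d) / 2 ^ d" "{..k}"] assms by (simp add: sums_iff)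
  then have "real N \<le> 2 ^ k * x"
    unfolding partial_sum by (simp add: divide_le_eq mult.commute)
  then have "int N \<le> \<lfloor>2 ^ k * x\<rfloor>" by (simp add: le_floor_iff)
  then have "real N \<le> of_int \<lfloor>2 ^ k * x\<rfloor>" by linarith
  then show ?thesis
    unfolding partial_sum binary_trunc_def by (rule divide_right_mono) simp
qed

section \<open>Subtraction without borrow\<close>

lemma eps_frac:
  assumes "0 < j"
  shows "eps (int j) (frac x) = eps (int j) x"
proof -
  have "2 ^ j * frac x = 2 ^ j * x - of_int (2 ^ j * \<lfloor>x\<rfloor>)"
    by (simp add: frac_def algebra_simps)
  then have "\<lfloor>2 ^ j * frac x\<rfloor> = \<lfloor>2 ^ j * x\<rfloor> - 2 ^ j * \<lfloor>x\<rfloor>"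
    by (simp only: floor_diff_of_int)
  then show ?thesis
    using assms by (auto simp: eps_def mod_diff_eq[symmetric] gr0_conv_Suc)
qed

lemma frac_le_of_eps_le:
  assumes "\<And>j. 0 < j \<Longrightarrow> eps (int j) x \<le> eps (int j) y"
  shows "frac x \<le> frac y"
proof (rule sums_le)
  show "(\<lambda>j. of_int (eps (int j) (frac x)) / 2 ^ j) sums frac x"
    "(\<lambda>j. of_int (eps (int j) (frac y)) / 2 ^ j) sums frac y"
    using frac_lt_1[of x] frac_lt_1[of y] by (auto intro!: eps_sums)
  fix j
  show "of_int (eps (int j) (frac x)) / 2 ^ j \<le> (of_int (eps (int j) (frac y)) / 2 ^ j :: real)"
  proof (cases "j = 0")
    case True
    then show ?thesis by (simp add: eps_nonpos_index frac_lt_1)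
  next
    case False
    then show ?thesis using assms by (simp add: eps_frac divide_right_mono)
  qed
qed

lemma eps_diff_no_borrow:
  assumes digitwise_le: "\<And>d. eps d y \<le> eps d x"
  shows "eps k (x - y) = eps k x - eps k y"
proof -
  let ?x = "2 powi k * x" and ?y = "2 powi k * y"
  have "frac ?y \<le> frac ?x"
    by (rule frac_le_of_eps_le) (simp add: eps_powi_mult digitwise_le)
  then have "\<lfloor>?x - ?y\<rfloor> = \<lfloor>?x\<rfloor> - \<lfloor>?y\<rfloor>"
    using frac_ge_0[of ?y] frac_lt_1[of ?x] unfolding floor_eq_iff frac_def of_int_diff by linarith
  then have "eps k (x - y) = (eps k x - eps k y) mod 2"
    by (simp add: eps_def mod_diff_eq right_diff_distrib)
  also have "\<dots> = eps k x - eps k y"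
    using digitwise_le[of k] eps_cases[of k x] eps_cases[of k y] by auto
  finally show ?thesis .
qed

context
  fixes p :: real
  assumes unit_interval: "0 \<le> p" "p < 1"
begin

lemma fps_nth_period_factor_digit_fps:
  "fps_nth ((1 - fps_X ^ l) * digit_fps p) d = eps (int d) p - eps (int d - int l) p"
  using eps_nonpos_index[OF unit_interval, of "int d - int l"]
  by (simp add: left_diff_distrib fps_X_power_mult_nth of_nat_diff)

lemma period_factor_digit_fps_nonneg_iff:
  "(\<forall>d. 0 \<le> fps_nth ((1 - fps_X ^ l) * digit_fps p) d)
     \<longleftrightarrow> (\<forall>d. eps (d - int l) p \<le> eps d p)"
proof -
  have "eps (d - int l) p \<le> eps d p" if "\<forall>n. eps (int n - int l) p \<le> eps (int n) p" for d
  proof (cases "0 \<le> d")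
    case True
    then show ?thesis using that by (metis nonneg_int_cases)
  next
    case False
    then show ?thesis
      using eps_nonpos_index[OF unit_interval, of "d - int l"] by simp
  qed
  then show ?thesis
    by (auto simp: fps_nth_period_factor_digit_fps)
qed

lemma eps_le_shift_iff:
  "(\<forall>d. eps (d - int l) p \<le> eps d p) \<longleftrightarrow> (\<forall>d\<ge>1. eps d p \<le> eps (d + int l) p)"
proof
  assume shift: "\<forall>d\<ge>1. eps d p \<le> eps (d + int l) p"
  show "\<forall>d. eps (d - int l) p \<le> eps d p"
  proof
    fix d show "eps (d - int l) p \<le> eps d p"
    proof (cases "1 \<le> d - int l")
      case True
      then show ?thesis using shift by (metis diff_add_cancel)
    next
      case False
      then show ?thesis
        using eps_nonpos_index[OF unit_interval, of "d - int l"] by simp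
    qed
  qed
qed (metis add_diff_cancel_right')

lemma period_factor_digit_fps_eq_iff:
  "(1 - fps_X ^ l) * digit_fps p = digit_fps (p - p / 2 ^ l)
     \<longleftrightarrow> (\<forall>d. 0 \<le> fps_nth ((1 - fps_X ^ l) * digit_fps p) d)"
proof
  assume "\<forall>d. 0 \<le> fps_nth ((1 - fps_X ^ l) * digit_fps p) d"
  then have "eps d (p / 2 ^ l) \<le> eps d p" for d
    by (simp only: period_factor_digit_fps_nonneg_iff eps_div_power2)
  then show "(1 - fps_X ^ l) * digit_fps p = digit_fps (p - p / 2 ^ l)"
    by (intro fps_ext) (simp only: fps_nth_period_factor_digit_fps digit_fps_nth
        eps_diff_no_borrow eps_div_power2)
qed simp

end

section \<open>Generating functions of trees\<close>

definition node_count :: "'a ddg \<Rightarrow> nat \<Rightarrow> 'a ddg \<Rightarrow> nat" where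
  "node_count t d s = card {w. length w = d \<and> node_at t w = Some s}"

definition node_fps :: "'a ddg \<Rightarrow> 'a ddg \<Rightarrow> int fps" where
  "node_fps t s = Abs_fps (\<lambda>d. int (node_count t d s))"

lemma node_fps_nth [simp]: "fps_nth (node_fps t s) d = int (node_count t d s)"
  by (simp add: node_fps_def)

lemma leaf_count_eq_node_count: "leaf_count t d i = node_count t d (Leaf i)"
  by (simp add: leaf_count_def node_count_def)

lemma node_count_0: "node_count t 0 s = of_bool (t = s)"
proof -
  have "{w. length w = 0 \<and> node_at t w = Some s} = (if t = s then {[]} else {})"
    by auto
  then show ?thesis by (simp add: node_count_def)
qed

lemma finite_bit_words: "finite {w :: bool list. length w = d \<and> Q w}"
  by (rule finite_subset[OF _ finite_lists_length_eq[OF finite, of UNIV d]]) auto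

lemma node_count_Suc_terminal:
  assumes "\<not> is_Node t"
  shows "node_count t (Suc d) s = 0"
proof -
  have "{w. length w = Suc d \<and> node_at t w = Some s} = {}"
    using assms by (cases t) (auto simp: length_Suc_conv)
  then show ?thesis unfolding node_count_def by (simp only: card.empty)
qed

lemma node_count_Suc_Node: "node_count (Node l r) (Suc d) s = node_count l d s + node_count r d s"
proof -
  let ?W = "\<lambda>t. {w. length w = d \<and> node_at t w = Some s}"
  have "{w. length w = Suc d \<and> node_at (Node l r) w = Some s}
      = (#) False ` ?W l \<union> (#) True ` ?W r"
    by (auto simp: length_Suc_conv split: if_splits)
  moreover have "card ((#) False ` ?W l \<union> (#) True ` ?W r) = card (?W l) + card (?W r)"
    by (subst card_Un_disjoint) (auto simp: finite_bit_words card_image)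
  ultimately show ?thesis by (simp add: node_count_def)
qed

lemma node_fps_terminal:
  assumes "\<not> is_Node t"
  shows "node_fps t s = of_bool (t = s)"
proof (rule fps_ext)
  fix d show "fps_nth (node_fps t s) d = fps_nth (of_bool (t = s)) d"
    using assms by (cases d) (simp_all add: node_count_0 node_count_Suc_terminal)
qed

lemma node_fps_Node:
  "node_fps (Node l r) s = of_bool (Node l r = s) + fps_X * (node_fps l s + node_fps r s)"
proof (rule fps_ext)
  fix d show "fps_nth (node_fps (Node l r) s) d =
      fps_nth (of_bool (Node l r = s) + fps_X * (node_fps l s + node_fps r s)) d"
    by (cases d) (simp_all add: node_count_0 node_count_Suc_Node)
qed

lemma reject_simps [simp]:
  "reject z (Leaf a) = (if a = z then Back else Leaf a)"
  "reject z (Node l r) = Node (reject z l) (reject z r)"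
  "reject z Back = Back"
  by (subst reject.code; simp)+

lemma unroll_from_simps [simp]:
  "unroll_from r (Leaf a) = Leaf a"
  "unroll_from r (Node t1 t2) = Node (unroll_from r t1) (unroll_from r t2)"
  by (subst unroll_from.code; simp)+

lemma unroll_from_Back: "unroll_from r Back = unroll r"
  unfolding unroll_def by (subst (1 2) unroll_from.code) simp

lemma node_fps_reject_Leaf:
  "node_fps (reject z t) (Leaf i) = (if i = z then 0 else node_fps t (Leaf i))"
proof (rule fps_ext)
  fix d show "fps_nth (node_fps (reject z t) (Leaf i)) d
      = fps_nth (if i = z then 0 else node_fps t (Leaf i)) d"
  proof (induction d arbitrary: t)
    case 0
    then show ?case by (cases t) (auto simp: node_count_0)
  next
    case (Suc d)
    then show ?case
      by (cases t) (auto simp: node_count_Suc_terminal node_count_Suc_Node)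
  qed
qed

lemma node_fps_reject_Back: "node_fps (reject z t) Back = node_fps t (Leaf z) + node_fps t Back"
proof (rule fps_ext)
  fix d show "fps_nth (node_fps (reject z t) Back) d
      = fps_nth (node_fps t (Leaf z) + node_fps t Back) d"
  proof (induction d arbitrary: t)
    case 0
    then show ?case by (cases t) (auto simp: node_count_0)
  next
    case (Suc d)
    then show ?case
      by (cases t) (auto simp: node_count_Suc_terminal node_count_Suc_Node)
  qed
qed

lemma node_fps_unroll_from:
  "node_fps (unroll_from r t) (Leaf i)
     = node_fps t (Leaf i) + node_fps t Back * node_fps (unroll r) (Leaf i)"
proof (rule fps_ext)
  let ?U = "node_fps (unroll r) (Leaf i)"
  fix d show "fps_nth (node_fps (unroll_from r t) (Leaf i)) d
      = fps_nth (node_fps t (Leaf i) + node_fps t Back * ?U) d"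
  proof (induction d arbitrary: t)
    case 0
    then show ?case
      by (cases t) (auto simp: node_fps_terminal unroll_from_Back node_count_0)
  next
    case (Suc d)
    show ?case
    proof (cases t)
      case (Node t1 t2)
      have "node_fps t (Leaf i) + node_fps t Back * ?U
          = fps_X * ((node_fps t1 (Leaf i) + node_fps t1 Back * ?U)
              + (node_fps t2 (Leaf i) + node_fps t2 Back * ?U))"
        by (simp add: Node node_fps_Node algebra_simps)
      then show ?thesis
        using Suc.IH[of t1] Suc.IH[of t2]
        by (simp only: fps_X_mult_nth fps_add_nth Node unroll_from_simps node_fps_nth
            node_count_Suc_Node of_nat_add) simp
    qed (simp_all add: node_fps_terminal node_count_Suc_terminal unroll_from_Back)
  qed
qed

lemma node_fps_unroll:
  "(1 - node_fps t Back) * node_fps (unroll t) (Leaf i) = node_fps t (Leaf i)"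
  using node_fps_unroll_from[of t t i] by (simp add: unroll_def algebra_simps)

section \<open>Random traversals\<close>

interpretation fair_bits: prob_space fair_bits
  unfolding fair_bits_def
  by (rule prob_space.prob_space_stream_space) (rule prob_space_measure_pmf)

lemma space_fair_bits [simp]: "space fair_bits = UNIV"
  by (simp add: fair_bits_def space_stream_space)

lemma sets_fair_bits [measurable_cong]:
  "sets fair_bits = sets (stream_space (count_space UNIV))"
  unfolding fair_bits_def by (rule sets_stream_space_cong) simp

lemma pred_stake [measurable]: "Measurable.pred fair_bits (\<lambda>\<omega>. Q (stake k \<omega>))"
  by measurable

lemma measure_stake_eq: "measure fair_bits {\<omega>. stake (length w) \<omega> = w} = (1/2) ^ length w"
proof -
  have "emeasure fair_bits {\<omega>. stake (length w) \<omega> = w} = ennreal ((1/2) ^ length w)"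
  proof (induction w)
    case Nil
    show ?case using fair_bits.emeasure_space_1 by simp
  next
    case (Cons b w)
    have "{\<omega>. stake (length (b # w)) \<omega> = b # w} \<in> sets fair_bits"
      using pred_stake[of "\<lambda>v. v = b # w"] by (simp only: pred_def space_fair_bits UNIV_I simp_thms)
    then have "emeasure fair_bits {\<omega>. stake (length (b # w)) \<omega> = b # w}
        = (\<integral>\<^sup>+ t. emeasure fair_bits {\<omega>. t = b \<and> stake (length w) \<omega> = w}
             \<partial>measure_pmf (bernoulli_pmf (1/2)))"
      unfolding fair_bits_def
      by (subst prob_space.emeasure_stream_space[OF prob_space_measure_pmf])
        (auto simp: space_stream_space)
    also have "\<dots> = (\<integral>\<^sup>+ t. ennreal ((1/2) ^ length w) * indicator {b} t
             \<partial>measure_pmf (bernoulli_pmf (1/2)))"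
      by (rule nn_integral_cong) (auto simp: Cons split: split_indicator)
    also have "\<dots> = ennreal ((1/2) ^ length w) * ennreal (1/2)"
      by (cases b) (simp_all add: nn_integral_cmult emeasure_pmf_single)
    also have "\<dots> = ennreal ((1/2) ^ length (b # w))"
      by (subst ennreal_mult'[symmetric]) (simp_all add: mult.commute)
    finally show ?case .
  qed
  then show ?thesis by (simp add: measure_def)
qed

definition node_event :: "'a ddg \<Rightarrow> nat \<Rightarrow> 'a ddg \<Rightarrow> bool stream set" where
  "node_event t k s = {\<omega>. node_at t (stake k \<omega>) = Some s}"

lemma sets_node_event [measurable]: "node_event t k s \<in> sets fair_bits"
  using pred_stake[of "\<lambda>w. node_at t w = Some s" k] by (simp add: node_event_def pred_def)

lemma measure_node_event: "measure fair_bits (node_event t k s) = real (node_count t k s) / 2 ^ k"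
proof -
  let ?W = "{w. length w = k \<and> node_at t w = Some s}"
  have "node_event t k s = (\<Union>w\<in>?W. {\<omega>. stake k \<omega> = w})"
    by (auto simp: node_event_def)
  also have "measure fair_bits \<dots> = (\<Sum>w\<in>?W. measure fair_bits {\<omega>. stake k \<omega> = w})"
    using finite_bit_words pred_stake[of "\<lambda>v. v = w" k for w]
    by (intro fair_bits.finite_measure_finite_Union) (auto simp: disjoint_family_on_def pred_def)
  also have "\<dots> = (\<Sum>w\<in>?W. (1/2) ^ k)"
    using measure_stake_eq by (intro sum.cong) auto
  finally show ?thesis by (simp add: node_count_def power_one_over field_simps)
qed

lemma node_event_empty: "node_count t k s = 0 \<Longrightarrow> node_event t k s = {}"
  unfolding node_count_def node_event_def card_eq_0_iff
  using finite_bit_words[of k "\<lambda>w. node_at t w = Some s"] length_stake by blast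

lemma node_at_below_terminal:
  assumes "\<not> is_Node s"
  shows "node_at t v = Some s \<Longrightarrow> node_at t (v @ w) = Some s' \<Longrightarrow> w = [] \<and> s' = s"
proof (induction v arbitrary: t)
  case Nil
  then show ?case using assms by (cases w; cases s) auto
next
  case (Cons b v)
  then show ?case by (cases t) auto
qed

lemma node_event_unique:
  assumes "\<omega> \<in> node_event t k s" "\<omega> \<in> node_event t k' s'" "\<not> is_Node s" "\<not> is_Node s'"
  shows "k = k' \<and> s = s'"
  using assms
proof (induction k k' arbitrary: s s' rule: linorder_wlog)
  case (le k k')
  have "stake k' \<omega> = stake k \<omega> @ stake (k' - k) (sdrop k \<omega>)"
    using le.hyps by simp
  then have "stake (k' - k) (sdrop k \<omega>) = [] \<and> s' = s"
    using le.prems unfolding node_event_def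
    by (intro node_at_below_terminal[of s t "stake k \<omega>"]) (simp_all del: stake_add)
  then show ?case
    using le.hyps by (metis length_stake list.size(3) diff_is_0_eq le_antisym)
next
  case (sym k k')
  then show ?case by metis
qed

definition reach_prob :: "'a ddg \<Rightarrow> 'a ddg \<Rightarrow> real" where
  "reach_prob t s = measure fair_bits (\<Union>k. node_event t k s)"

lemma node_count_sums_reach_prob:
  assumes "\<not> is_Node s"
  shows "(\<lambda>d. real (node_count t d s) / 2 ^ d) sums reach_prob t s"
proof -
  have "(\<lambda>k. measure fair_bits (node_event t k s)) sums reach_prob t s"
    unfolding reach_prob_def
    by (rule fair_bits.finite_measure_UNION)
      (auto simp: disjoint_family_on_def dest: node_event_unique[OF _ _ assms assms])
  then show ?thesis by (simp add: measure_node_event)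
qed

lemma sum_reach_prob_le_1:
  assumes "finite S" "\<And>s. s \<in> S \<Longrightarrow> \<not> is_Node s"
  shows "(\<Sum>s\<in>S. reach_prob t s) \<le> 1"
proof -
  have "disjoint_family_on (\<lambda>s. \<Union>k. node_event t k s) S"
    using assms(2) by (auto simp: disjoint_family_on_def dest: node_event_unique)
  then have "(\<Sum>s\<in>S. reach_prob t s) = measure fair_bits (\<Union>s\<in>S. \<Union>k. node_event t k s)"
    unfolding reach_prob_def using assms(1)
    by (intro fair_bits.finite_measure_finite_Union[symmetric]) auto
  then show ?thesis by simp
qed

lemma node_fps_eq_0_of_reach_prob:
  assumes "\<not> is_Node s" "reach_prob t s = 0"
  shows "node_fps t s = 0"
proof (rule fps_ext)
  fix d
  have "(\<lambda>d. real (node_count t d s) / 2 ^ d) sums 0"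
    using node_count_sums_reach_prob[of s t] assms by simp
  then have "real (node_count t d s) / 2 ^ d = 0"
    using suminf_eq_zero_iff[of "\<lambda>d. real (node_count t d s) / 2 ^ d"] by (auto simp: sums_iff)
  then show "fps_nth (node_fps t s) d = fps_nth 0 d" by simp
qed

lemma has_output_distribution_iff:
  "has_output_distribution t P \<longleftrightarrow> (\<forall>i. reach_prob (unroll t) (Leaf i) = P i)"
proof -
  have "{\<omega>. outputs t \<omega> i} = (\<Union>k. node_event (unroll t) k (Leaf i))" for i
    by (auto simp: outputs_def node_event_def)
  then show ?thesis by (simp add: has_output_distribution_def reach_prob_def)
qed

lemma real_node_count_eq_digit:
  "node_fps t s = digit_fps x \<Longrightarrow> real (node_count t d s) = of_int (eps (int d) x)"
  by (metis node_fps_nth digit_fps_nth of_int_of_nat_eq)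

lemma reach_prob_eq_of_digits:
  assumes "node_fps t s = digit_fps x" "\<not> is_Node s" "0 \<le> x" "x < 2"
  shows "reach_prob t s = x"
  using node_count_sums_reach_prob[OF assms(2), of t] eps_sums[OF assms(3,4)]
  by (simp add: real_node_count_eq_digit[OF assms(1)] sums_unique2)

definition reach_prob_within :: "nat \<Rightarrow> 'a ddg \<Rightarrow> 'a ddg \<Rightarrow> real" where
  "reach_prob_within k t s = (\<Sum>d\<le>k. real (node_count t d s) / 2 ^ d)"

lemma reach_prob_within_le:
  "\<not> is_Node s \<Longrightarrow> reach_prob_within k t s \<le> binary_trunc k (reach_prob t s)"
  unfolding reach_prob_within_def by (intro sum_le_binary_trunc node_count_sums_reach_prob)

lemma reach_prob_within_eq_binary_trunc_iff:
  assumes "0 \<le> x" "x < 2"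
  shows "(\<forall>k. reach_prob_within k t s = binary_trunc k x) \<longleftrightarrow> node_fps t s = digit_fps x"
proof
  assume "node_fps t s = digit_fps x"
  then show "\<forall>k. reach_prob_within k t s = binary_trunc k x"
    using sum_eps_eq_binary_trunc[OF assms]
    by (simp add: reach_prob_within_def real_node_count_eq_digit)
next
  assume partial_sums: "\<forall>k. reach_prob_within k t s = binary_trunc k x"
  have "real (node_count t d s) / 2 ^ d = of_int (eps (int d) x) / 2 ^ d" for d
  proof (cases d)
    case 0
    then show ?thesis using partial_sums[rule_format, of 0] assms
      by (simp add: reach_prob_within_def binary_trunc_def eps_def)
  next
    case (Suc k)
    have "reach_prob_within (Suc k) t s = reach_prob_within k t s + real (node_count t d s) / 2 ^ d"
      by (simp add: reach_prob_within_def Suc)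
    then show ?thesis using partial_sums by (simp add: binary_trunc_Suc Suc)
  qed
  then have "real_of_int (int (node_count t d s)) = of_int (eps (int d) x)" for d
    by simp
  then show "node_fps t s = digit_fps x"
    by (intro fps_ext) (simp only: of_int_eq_iff node_fps_nth digit_fps_nth)
qed

section \<open>The expected number of bits\<close>

definition halted :: "'a ddg \<Rightarrow> nat \<Rightarrow> bool stream \<Rightarrow> bool" where
  "halted t k \<omega> \<longleftrightarrow> (\<exists>i. \<omega> \<in> node_event (unroll t) k (Leaf i))"

lemma pred_halted [measurable]: "Measurable.pred fair_bits (halted t k)"
  using pred_stake[of "\<lambda>w. \<exists>i. node_at (unroll t) w = Some (Leaf i)" k]
  by (simp add: halted_def[abs_def] node_event_def)

lemma bits_consumed_eq_LEAST:
  "bits_consumed t \<omega> = (if \<exists>k. halted t k \<omega> then enat (LEAST k. halted t k \<omega>) else \<infinity>)"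
proof -
  let ?K = "{k. halted t k \<omega>}"
  have bits_consumed_Inf: "bits_consumed t \<omega> = Inf (enat ` ?K)"
    by (simp add: bits_consumed_def halted_def node_event_def image_Collect)
  show ?thesis
  proof (cases "\<exists>k. halted t k \<omega>")
    case True
    have "Inf (enat ` ?K) = enat (LEAST k. halted t k \<omega>)"
    proof (rule antisym)
      show "Inf (enat ` ?K) \<le> enat (LEAST k. halted t k \<omega>)"
        using LeastI_ex[OF True] by (intro Inf_lower imageI) simp
      show "enat (LEAST k. halted t k \<omega>) \<le> Inf (enat ` ?K)"
        by (rule Inf_greatest) (auto intro: Least_le)
    qed
    then show ?thesis using True by (simp add: bits_consumed_Inf)
  next
    case False
    then show ?thesis by (simp add: bits_consumed_Inf top_enat_def)
  qed
qed

lemma less_bits_consumed_iff: "enat k < bits_consumed t \<omega> \<longleftrightarrow> (\<forall>d\<le>k. \<not> halted t d \<omega>)"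
proof (cases "\<exists>d. halted t d \<omega>")
  case True
  have "k < (LEAST d. halted t d \<omega>) \<longleftrightarrow> (\<forall>d\<le>k. \<not> halted t d \<omega>)"
    using LeastI_ex[OF True] not_less_Least[of _ "\<lambda>d. halted t d \<omega>"] le_less_trans not_less by metis
  then show ?thesis using True by (simp add: bits_consumed_eq_LEAST)
next
  case False
  then show ?thesis by (simp add: bits_consumed_eq_LEAST)
qed

lemma measurable_bits_consumed [measurable]: "bits_consumed t \<in> fair_bits \<rightarrow>\<^sub>M count_space UNIV"
proof -
  have "bits_consumed t
      = (\<lambda>\<omega>. if \<exists>k. halted t k \<omega> then enat (LEAST k. halted t k \<omega>) else \<infinity>)"
    by (rule ext) (rule bits_consumed_eq_LEAST)
  then show ?thesis by simp
qed

lemma measure_bits_consumed_le: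
  assumes finite_I: "finite I" and support: "\<And>i. i \<notin> I \<Longrightarrow> node_fps (unroll t) (Leaf i) = 0"
  shows "measure fair_bits {\<omega>. bits_consumed t \<omega> \<le> enat k}
    = (\<Sum>i\<in>I. reach_prob_within k (unroll t) (Leaf i))"
proof -
  let ?E = "\<lambda>(i, d). node_event (unroll t) d (Leaf i)"
  have "node_event (unroll t) d (Leaf i) = {}" if "i \<notin> I" for i d
    using support[OF that] by (metis node_event_empty node_fps_nth fps_zero_nth of_nat_eq_0_iff)
  then have "{\<omega>. bits_consumed t \<omega> \<le> enat k} = (\<Union>p\<in>I \<times> {..k}. ?E p)"
    by (fastforce simp: less_bits_consumed_iff halted_def simp flip: not_less)
  also have "measure fair_bits \<dots> = (\<Sum>p\<in>I \<times> {..k}. measure fair_bits (?E p))"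
    using finite_I by (intro fair_bits.finite_measure_finite_Union)
      (auto simp: disjoint_family_on_def dest: node_event_unique)
  also have "\<dots> = (\<Sum>i\<in>I. reach_prob_within k (unroll t) (Leaf i))"
    by (simp add: reach_prob_within_def measure_node_event sum.cartesian_product case_prod_beta)
  finally show ?thesis .
qed

lemma expected_bits_eq:
  assumes "finite I" "\<And>i. i \<notin> I \<Longrightarrow> node_fps (unroll t) (Leaf i) = 0"
  shows "expected_bits t =
    (\<Sum>k. ennreal (1 - (\<Sum>i\<in>I. reach_prob_within k (unroll t) (Leaf i))))"
proof -
  have "emeasure fair_bits {\<omega>. enat k < bits_consumed t \<omega>}
      = ennreal (1 - (\<Sum>i\<in>I. reach_prob_within k (unroll t) (Leaf i)))" for k
  proof -
    have "{\<omega>. enat k < bits_consumed t \<omega>} = UNIV - {\<omega>. bits_consumed t \<omega> \<le> enat k}"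
      by auto
    moreover have "{\<omega> \<in> space fair_bits. bits_consumed t \<omega> \<le> enat k} \<in> sets fair_bits"
      by measurable
    ultimately show ?thesis
      using fair_bits.prob_compl[of "{\<omega>. bits_consumed t \<omega> \<le> enat k}"]
      by (simp add: fair_bits.emeasure_eq_measure measure_bits_consumed_le[OF assms])
  qed
  then show ?thesis
    unfolding expected_bits_def by (simp add: nn_integral_enat_function)
qed

section \<open>Trees with prescribed leaves\<close>

text \<open>Level \<open>d\<close> of the tree lists its leaves \<open>L d\<close> first; \<open>j\<close> is the position of a node within its
  level.\<close>

primcorec grow :: "(nat \<Rightarrow> 'a list) \<Rightarrow> nat \<Rightarrow> nat \<Rightarrow> 'a ddg" where
  "grow L d j =
    (if j < length (L d) then Leaf (L d ! j)
     else Node (grow L (Suc d) (2 * (j - length (L d))))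
       (grow L (Suc d) (2 * (j - length (L d)) + 1)))"

primrec level_size :: "(nat \<Rightarrow> 'a list) \<Rightarrow> nat \<Rightarrow> nat" where
  "level_size L 0 = 1"
| "level_size L (Suc d) = 2 * (level_size L d - length (L d))"

lemma grow_Leaf: "j < length (L d) \<Longrightarrow> grow L d j = Leaf (L d ! j)"
  by (subst grow.code) simp

lemma grow_Node:
  "grow L d (j + length (L d)) = Node (grow L (Suc d) (2 * j)) (grow L (Suc d) (2 * j + 1))"
  by (subst grow.code) simp

lemma length_le_level_size_of_kraft:
  assumes kraft: "\<And>k. (\<Sum>d\<le>k. real (length (L d)) / 2 ^ d) \<le> 1"
  shows "length (L d) \<le> level_size L d"
proof -
  let ?used = "\<lambda>d. \<Sum>e<d. real (length (L e)) / 2 ^ e"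
  have length_le: "length (L d) \<le> level_size L d"
    if "real (level_size L d) = 2 ^ d * (1 - ?used d)" for d
  proof -
    have "?used d + real (length (L d)) / 2 ^ d \<le> 1"
      using kraft[of d] by (simp flip: lessThan_Suc_atMost)
    then have "real (length (L d)) \<le> real (level_size L d)"
      unfolding that by (simp add: field_simps)
    then show ?thesis by simp
  qed
  have "real (level_size L d) = 2 ^ d * (1 - ?used d)" for d
  proof (induction d)
    case (Suc d)
    then have "real (level_size L (Suc d)) = 2 * (2 ^ d * (1 - ?used d) - real (length (L d)))"
      using length_le[OF Suc] by (simp add: of_nat_diff)
    then show ?case by (simp add: algebra_simps)
  qed simp
  then show ?thesis by (rule length_le)
qed

lemma sum_node_fps_grow:
  assumes "length (L d) \<le> level_size L d"
  shows "(\<Sum>j<level_size L d. node_fps (grow L d j) (Leaf i)) = of_nat (count_list (L d) i)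
    + fps_X * (\<Sum>j<level_size L (Suc d). node_fps (grow L (Suc d) j) (Leaf i))"
proof -
  let ?f = "\<lambda>d j. node_fps (grow L d j) (Leaf i)"
  have pair_sum: "(\<Sum>j<r. h (2 * j) + h (2 * j + 1)) = (\<Sum>j<2 * r. h j)"
    for h :: "nat \<Rightarrow> int fps" and r
    by (induction r) (simp_all add: algebra_simps)
  obtain r where level_size: "level_size L d = r + length (L d)"
    using assms by (metis add.commute le_Suc_ex)
  have "(\<Sum>j<level_size L d. ?f d j)
      = (\<Sum>j<length (L d). ?f d j) + (\<Sum>j<r. ?f d (j + length (L d)))"
    using sum.atLeastLessThan_concat[of 0 "length (L d)" "r + length (L d)" "?f d"]
      sum.shift_bounds_nat_ivl[of "?f d" 0 "length (L d)" r]
    by (simp add: level_size lessThan_atLeast0)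
  also have "(\<Sum>j<length (L d). ?f d j) = (\<Sum>j<length (L d). of_bool (L d ! j = i))"
    by (simp add: grow_Leaf node_fps_terminal)
  also have "\<dots> = of_nat (card {j. j < length (L d) \<and> i = L d ! j})"
    by (simp add: Int_def eq_commute)
  also have "\<dots> = of_nat (count_list (L d) i)"
    by (simp add: count_list_eq_length_filter length_filter_conv_card)
  also have "(\<Sum>j<r. ?f d (j + length (L d)))
      = (\<Sum>j<r. fps_X * (?f (Suc d) (2 * j) + ?f (Suc d) (2 * j + 1)))"
    by (simp only: grow_Node node_fps_Node) simp
  also have "\<dots> = fps_X * (\<Sum>j<2 * r. ?f (Suc d) j)"
    by (simp only: pair_sum[symmetric] sum_distrib_left)
  finally show ?thesis by (simp add: level_size)
qed

lemma ex_tree_of_kraft: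
  fixes L :: "nat \<Rightarrow> 'a list"
  assumes kraft: "\<And>k. (\<Sum>d\<le>k. real (length (L d)) / 2 ^ d) \<le> 1"
  shows "\<exists>t. \<forall>d i. node_count t d (Leaf i) = count_list (L d) i"
proof -
  let ?level = "\<lambda>d i. \<Sum>j<level_size L d. node_fps (grow L d j) (Leaf i)"
  have level: "?level d i = of_nat (count_list (L d) i) + fps_X * ?level (Suc d) i" for d i
    by (rule sum_node_fps_grow[OF length_le_level_size_of_kraft[OF kraft]])
  have level_nth: "fps_nth (?level d i) e = int (count_list (L (d + e)) i)" for d e i
  proof (induction e arbitrary: d)
    case 0
    show ?case by (subst level) (simp flip: fps_of_nat)
  next
    case (Suc e)
    show ?case
      using Suc[of "Suc d"] by (subst level) (simp flip: fps_of_nat del: level_size.simps)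
  qed
  have "node_count (grow L 0 0) d (Leaf i) = count_list (L d) i" for d i
    using level_nth[of 0 i d] by simp
  then show ?thesis by blast
qed

section \<open>The Knuth-Yao theorem\<close>

lemma suminf_ennreal_eq_imp_eq:
  fixes f g :: "nat \<Rightarrow> ennreal"
  assumes f_le_g: "\<And>k. f k \<le> g k" and sum_eq: "suminf g = suminf f" and finite_sum: "suminf f \<noteq> \<top>"
  shows "f k = g k"
proof -
  have g_eq: "g k = f k + (g k - f k)" for k
    using f_le_g by (metis add_diff_inverse_ennreal)
  have "suminf f + 0 = suminf f + (\<Sum>k. g k - f k)"
    using sum_eq suminf_add[of f "\<lambda>k. g k - f k"] by (simp flip: g_eq)
  then have "(\<Sum>k. g k - f k) = 0"
    using finite_sum by (metis ennreal_add_left_cancel infinity_ennreal_def)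
  then have "g k - f k = 0"
    by (simp add: suminf_eq_zero_iff)
  then show ?thesis using g_eq[of k] by simp
qed

locale finite_distribution =
  fixes I :: "'a set" and P :: "'a \<Rightarrow> real"
  assumes finite_support: "finite I"
    and nonneg: "\<And>i. 0 \<le> P i"
    and outside_support: "\<And>i. i \<notin> I \<Longrightarrow> P i = 0"
    and sum_eq_1: "sum P I = 1"
begin

lemma less_2: "P i < 2"
  using member_le_sum[of i I P] finite_support nonneg sum_eq_1 outside_support[of i] by fastforce

definition optimal_cost :: ennreal where
  "optimal_cost = (\<Sum>k. ennreal (1 - (\<Sum>i\<in>I. binary_trunc k (P i))))"

lemma sum_binary_trunc_le_1: "(\<Sum>i\<in>I. binary_trunc k (P i)) \<le> 1"
  unfolding sum_eq_1[symmetric] by (intro sum_mono binary_trunc_le)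

lemma optimal_cost_finite: "optimal_cost \<noteq> \<top>"
proof -
  have "norm (1 - (\<Sum>i\<in>I. binary_trunc k (P i))) \<le> real (card I) * (1/2) ^ k" for k
  proof -
    have "1 - (\<Sum>i\<in>I. binary_trunc k (P i)) = (\<Sum>i\<in>I. P i - binary_trunc k (P i))"
      by (simp add: sum_subtractf sum_eq_1)
    also have "\<dots> \<le> (\<Sum>i\<in>I. (1/2) ^ k)"
      by (intro sum_mono diff_binary_trunc_le)
    finally show ?thesis using sum_binary_trunc_le_1[of k] by simp
  qed
  then have "summable (\<lambda>k. 1 - (\<Sum>i\<in>I. binary_trunc k (P i)))"
    by (rule summable_comparison_test'[rotated]) (intro summable_mult summable_geometric, simp)
  then have "optimal_cost = ennreal (\<Sum>k. 1 - (\<Sum>i\<in>I. binary_trunc k (P i)))"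
    unfolding optimal_cost_def using sum_binary_trunc_le_1 by (intro suminf_ennreal2) auto
  then show ?thesis by simp
qed

lemma no_back_edges_of_digits:
  assumes "\<And>i. i \<in> I \<Longrightarrow> node_fps t (Leaf i) = digit_fps (P i)"
  shows "node_fps t Back = 0"
proof (rule node_fps_eq_0_of_reach_prob)
  have "(\<Sum>s\<in>Leaf ` I. reach_prob t s) = (\<Sum>i\<in>I. reach_prob t (Leaf i))"
    by (subst sum.reindex) (auto simp: inj_on_def)
  also have "\<dots> = 1"
    unfolding sum_eq_1[symmetric]
    by (intro sum.cong reach_prob_eq_of_digits[OF assms]) (auto simp: nonneg less_2)
  finally have "(\<Sum>s\<in>Leaf ` I. reach_prob t s) = 1" .
  moreover have "(\<Sum>s\<in>insert Back (Leaf ` I). reach_prob t s) \<le> 1"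
    by (rule sum_reach_prob_le_1) (use finite_support in auto)
  ultimately have "reach_prob t Back \<le> 0"
    by (simp add: finite_support image_iff)
  then show "reach_prob t Back = 0" by (simp add: reach_prob_def antisym)
qed simp

lemma unrolled_digits:
  assumes "\<And>i. node_fps t (Leaf i) = digit_fps (P i)"
  shows "node_fps (unroll t) (Leaf i) = digit_fps (P i)"
  using node_fps_unroll[of t i] no_back_edges_of_digits[OF assms] by (simp add: assms)

lemma has_output_distribution_of_digits:
  assumes "\<And>i. node_fps (unroll t) (Leaf i) = digit_fps (P i)"
  shows "has_output_distribution t P"
  unfolding has_output_distribution_iff
  using reach_prob_eq_of_digits[OF assms] nonneg less_2 by simp

lemma ex_digit_tree: "\<exists>t. \<forall>i. node_fps (unroll t) (Leaf i) = digit_fps (P i)"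
proof -
  have "\<exists>xs. set xs = {i \<in> I. eps (int d) (P i) = 1} \<and> distinct xs" for d
    using finite_support by (intro finite_distinct_list) auto
  then obtain L where set_L: "\<And>d. set (L d) = {i \<in> I. eps (int d) (P i) = 1}"
    and distinct_L: "\<And>d. distinct (L d)"
    by metis
  have count: "int (count_list (L d) i) = eps (int d) (P i)" for d i
  proof -
    have "count_list (L d) i = of_bool (i \<in> set (L d))"
      using distinct_L[of d] by (metis count_mset distinct_count_atmost_1 of_bool_def)
    then show ?thesis
      using eps_cases[of "int d" "P i"] outside_support[of i] by (auto simp: set_L eps_def)
  qed
  have "(\<Sum>d\<le>k. real (length (L d)) / 2 ^ d) \<le> 1" for k
  proof -
    have "real (length (L d)) = (\<Sum>i\<in>I. of_int (eps (int d) (P i)))" for d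
    proof -
      have "length (L d) = (\<Sum>i\<in>I. count_list (L d) i)"
        by (rule sum_count_set[symmetric]) (auto simp: set_L finite_support)
      then show ?thesis by (simp flip: count)
    qed
    then have "(\<Sum>d\<le>k. real (length (L d)) / 2 ^ d)
        = (\<Sum>i\<in>I. \<Sum>d\<le>k. of_int (eps (int d) (P i)) / 2 ^ d)"
      by (simp add: sum_divide_distrib sum.swap[of _ I])
    also have "\<dots> = (\<Sum>i\<in>I. binary_trunc k (P i))"
      using nonneg less_2 by (simp add: sum_eps_eq_binary_trunc)
    finally show ?thesis using sum_binary_trunc_le_1[of k] by simp
  qed
  then obtain t where "\<And>d i. node_count t d (Leaf i) = count_list (L d) i"
    using ex_tree_of_kraft by blast
  then have "node_fps t (Leaf i) = digit_fps (P i)" for i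
    by (intro fps_ext) (simp add: count)
  then show ?thesis using unrolled_digits by blast
qed

context
  fixes t :: "'a ddg"
  assumes has_output: "has_output_distribution t P"
begin

lemma reach_prob_within_le_binary_trunc:
  "reach_prob_within k (unroll t) (Leaf i) \<le> binary_trunc k (P i)"
  using reach_prob_within_le[of "Leaf i" k "unroll t"] has_output
  by (simp add: has_output_distribution_iff)

lemma node_fps_outside_support:
  assumes "i \<notin> I"
  shows "node_fps (unroll t) (Leaf i) = 0"
  using has_output outside_support[OF assms]
  by (intro node_fps_eq_0_of_reach_prob) (simp_all add: has_output_distribution_iff)

lemma expected_bits_eq_sum_unreached:
  "expected_bits t = (\<Sum>k. ennreal (1 - (\<Sum>i\<in>I. reach_prob_within k (unroll t) (Leaf i))))"
  by (rule expected_bits_eq[OF finite_support node_fps_outside_support])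

lemma optimal_cost_le_expected_bits: "optimal_cost \<le> expected_bits t"
  unfolding optimal_cost_def expected_bits_eq_sum_unreached
  by (intro suminf_le summableI ennreal_leI diff_left_mono sum_mono
      reach_prob_within_le_binary_trunc)

lemma reach_prob_within_eq_binary_trunc_of_optimal_cost:
  assumes cost: "expected_bits t = optimal_cost" and "i \<in> I"
  shows "reach_prob_within k (unroll t) (Leaf i) = binary_trunc k (P i)"
proof -
  let ?S = "\<lambda>k. \<Sum>i\<in>I. reach_prob_within k (unroll t) (Leaf i)"
  let ?T = "\<lambda>k. \<Sum>i\<in>I. binary_trunc k (P i)"
  have S_le_T: "?S k \<le> ?T k" for k
    by (intro sum_mono reach_prob_within_le_binary_trunc)
  have "ennreal (1 - ?T k) = ennreal (1 - ?S k)"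
    by (rule suminf_ennreal_eq_imp_eq)
      (use S_le_T cost optimal_cost_finite in
        \<open>simp_all add: expected_bits_eq_sum_unreached optimal_cost_def ennreal_leI\<close>)
  then have "?S k = ?T k"
    using S_le_T[of k] sum_binary_trunc_le_1[of k] by (simp add: ennreal_inj)
  then have "(\<Sum>i\<in>I. binary_trunc k (P i) - reach_prob_within k (unroll t) (Leaf i)) = 0"
    by (simp add: sum_subtractf)
  then show ?thesis
    using \<open>i \<in> I\<close> finite_support reach_prob_within_le_binary_trunc
    by (subst (asm) sum_nonneg_eq_0_iff) auto
qed

lemma expected_bits_eq_optimal_cost_iff:
  "expected_bits t = optimal_cost \<longleftrightarrow> (\<forall>i. node_fps (unroll t) (Leaf i) = digit_fps (P i))"
proof
  assume "\<forall>i. node_fps (unroll t) (Leaf i) = digit_fps (P i)"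
  then have "reach_prob_within k (unroll t) (Leaf i) = binary_trunc k (P i)" for k i
    using reach_prob_within_eq_binary_trunc_iff nonneg less_2 by blast
  then show "expected_bits t = optimal_cost"
    by (simp add: expected_bits_eq_sum_unreached optimal_cost_def)
next
  assume cost: "expected_bits t = optimal_cost"
  show "\<forall>i. node_fps (unroll t) (Leaf i) = digit_fps (P i)"
  proof
    fix i show "node_fps (unroll t) (Leaf i) = digit_fps (P i)"
    proof (cases "i \<in> I")
      case True
      then show ?thesis
        using reach_prob_within_eq_binary_trunc_of_optimal_cost[OF cost]
          reach_prob_within_eq_binary_trunc_iff[OF nonneg less_2] by blast
    next
      case False
      then show ?thesis by (simp add: node_fps_outside_support outside_support)
    qed
  qed
qed

end

theorem entropy_optimal_iff_digits:
  "entropy_optimal P t \<longleftrightarrow> (\<forall>i. node_fps (unroll t) (Leaf i) = digit_fps (P i))"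
proof -
  obtain t' where "\<forall>i. node_fps (unroll t') (Leaf i) = digit_fps (P i)"
    using ex_digit_tree by blast
  then have "has_output_distribution t' P" "expected_bits t' = optimal_cost"
    using has_output_distribution_of_digits expected_bits_eq_optimal_cost_iff by blast+
  then have "entropy_optimal P t \<longleftrightarrow> has_output_distribution t P \<and> expected_bits t = optimal_cost"
    unfolding entropy_optimal_def using optimal_cost_le_expected_bits by (metis antisym)
  then show ?thesis
    using has_output_distribution_of_digits expected_bits_eq_optimal_cost_iff by blast
qed

end

section \<open>Unrolled FLDR and ALDR trees\<close>

lemma ceiling_log2_le_iff:
  assumes "0 < m"
  shows "\<lceil>log 2 (real m)\<rceil> \<le> int K \<longleftrightarrow> m \<le> 2 ^ K"
proof -
  have "\<lceil>log 2 (real m)\<rceil> \<le> int K \<longleftrightarrow> real m \<le> real (2 ^ K)"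
    using assms by (simp add: ceiling_le_iff log_le_iff powr_realpow)
  then show ?thesis by (simp only: of_nat_le_iff)
qed

lemma fldr_depth_le_iff:
  assumes "0 < (\<Sum>i=1..n. A i)"
  shows "fldr_depth n A \<le> K \<longleftrightarrow> (\<Sum>i=1..n. A i) \<le> 2 ^ K"
  unfolding fldr_depth_def nat_le_iff by (rule ceiling_log2_le_iff[OF assms])

lemma fldr_depth_eqI:
  assumes "2 ^ K < 2 * (\<Sum>i=1..n. A i)" "(\<Sum>i=1..n. A i) \<le> 2 ^ K"
  shows "fldr_depth n A = K"
proof (rule antisym)
  have sum_pos: "0 < (\<Sum>i=1..n. A i)" using assms(1) by (auto intro!: gr0I)
  then show "fldr_depth n A \<le> K"
    using assms(2) by (simp only: fldr_depth_le_iff)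
  have "(\<Sum>i=1..n. A i) \<le> 2 ^ fldr_depth n A"
    using fldr_depth_le_iff[OF sum_pos, of "fldr_depth n A"] by blast
  then have "(2 :: nat) ^ K < 2 ^ Suc (fldr_depth n A)"
    using assms(1) by simp
  then have "K < Suc (fldr_depth n A)"
    by (rule power_less_imp_less_exp[rotated]) simp
  then show "K \<le> fldr_depth n A" by simp
qed

lemma finite_distribution_fldr_proposal:
  assumes "0 < (\<Sum>i=1..n. A i)"
  shows "finite_distribution {0..n} (fldr_proposal n A)"
proof
  let ?M = "\<Sum>i=1..n. A i" and ?K = "fldr_depth n A"
  have "(\<Sum>i\<in>{0..n}. fldr_proposal n A i) = fldr_proposal n A 0 + (\<Sum>i=1..n. fldr_proposal n A i)"
    by (subst sum.atLeast_Suc_atMost) auto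
  also have "(\<Sum>i=1..n. fldr_proposal n A i) = (\<Sum>i=1..n. real (A i) / 2 ^ ?K)"
    by (rule sum.cong) (auto simp: fldr_proposal_def)
  also have "\<dots> = real ?M / 2 ^ ?K"
    by (simp add: sum_divide_distrib)
  finally show "sum (fldr_proposal n A) {0..n} = 1"
    using fldr_depth_le_iff[OF assms, of ?K]
    by (simp add: fldr_proposal_def of_nat_diff flip: add_divide_distrib)
qed (auto simp: fldr_proposal_def)

lemma node_fps_unroll_FLDR:
  assumes t: "is_FLDR n A t" and pos: "0 < (\<Sum>i=1..n. A i)"
  shows "(1 - digit_fps (fldr_proposal n A 0)) * node_fps (unroll t) (Leaf i)
    = (if i \<in> {1..n} then digit_fps (fldr_proposal n A i) else 0)"
proof -
  interpret proposal: finite_distribution "{0..n}" "fldr_proposal n A"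
    by (rule finite_distribution_fldr_proposal[OF pos])
  obtain t0 where "\<forall>d i. int (leaf_count t0 d i) = eps (int d) (fldr_proposal n A i)"
    and t_eq: "t = reject 0 t0"
    using t unfolding is_FLDR_def by blast
  then have digits: "node_fps t0 (Leaf i) = digit_fps (fldr_proposal n A i)" for i
    by (intro fps_ext) (simp add: leaf_count_eq_node_count)
  have "node_fps t Back = digit_fps (fldr_proposal n A 0)"
    using proposal.no_back_edges_of_digits[OF digits]
    by (simp add: t_eq node_fps_reject_Back digits)
  moreover have "node_fps t (Leaf i) = (if i \<in> {1..n} then digit_fps (fldr_proposal n A i) else 0)"
    by (auto simp: t_eq node_fps_reject_Leaf digits proposal.outside_support)
  ultimately show ?thesis
    using node_fps_unroll[of t i] by simp
qed

definition normalized_weights :: "nat \<Rightarrow> (nat \<Rightarrow> nat) \<Rightarrow> nat \<Rightarrow> real" where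
  "normalized_weights n a i = (if i \<in> {1..n} then real (a i) / real (\<Sum>j=1..n. a j) else 0)"

definition rejection_prob :: "nat \<Rightarrow> nat \<Rightarrow> real" where
  "rejection_prob m K = real (2 ^ K mod m) / 2 ^ K"

lemma finite_distribution_normalized_weights:
  assumes "0 < (\<Sum>i=1..n. a i)"
  shows "finite_distribution {1..n} (normalized_weights n a)"
proof
  have "sum (normalized_weights n a) {1..n} = (\<Sum>i=1..n. real (a i) / real (\<Sum>j=1..n. a j))"
    by (rule sum.cong) (simp_all add: normalized_weights_def)
  also have "\<dots> = real (\<Sum>i=1..n. a i) / real (\<Sum>j=1..n. a j)"
    by (simp only: sum_divide_distrib of_nat_sum)
  also have "\<dots> = 1"
    using assms by (intro divide_self) (simp only: of_nat_eq_0_iff neq0_conv)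
  finally show "sum (normalized_weights n a) {1..n} = 1" .
qed (auto simp: normalized_weights_def simp del: of_nat_sum)

lemma rejection_prob_bounds:
  assumes "0 < m" "m \<le> 2 ^ K"
  shows "0 \<le> rejection_prob m K" "rejection_prob m K < 1"
proof -
  have "real (2 ^ K mod m) < real (2 ^ K)"
    using assms by (meson less_le_trans mod_less_divisor of_nat_less_iff)
  then show "rejection_prob m K < 1" by (simp add: rejection_prob_def)
qed (simp add: rejection_prob_def)

lemma fldr_proposal_ALDR:
  assumes m_eq: "m = (\<Sum>i=1..n. a i)" and m_pos: "0 < m" and m_le: "m \<le> 2 ^ K"
  defines "A \<equiv> \<lambda>i. 2 ^ K div m * a i"
  shows "fldr_proposal n A 0 = rejection_prob m K"
    and "i \<in> {1..n} \<Longrightarrow> fldr_proposal n A i = real (2 ^ K div m * a i) / 2 ^ K"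
proof -
  have sum_A: "(\<Sum>i=1..n. A i) = 2 ^ K div m * m"
    by (simp add: A_def m_eq sum_distrib_left)
  have "1 \<le> 2 ^ K div m"
    using m_pos m_le by (simp add: Suc_leI div_greater_zero_iff)
  then have "2 ^ K mod m < 2 ^ K div m * m"
    using m_pos by (metis less_le_trans mod_less_divisor mult_le_mono1 mult_1)
  then have depth: "fldr_depth n A = K"
    using div_mult_mod_eq[of "2 ^ K" m] unfolding sum_A[symmetric]
    by (intro fldr_depth_eqI) linarith+
  have "2 ^ K - 2 ^ K div m * m = 2 ^ K mod m"
    by (rule minus_div_mult_eq_mod)
  then show "fldr_proposal n A 0 = rejection_prob m K"
    unfolding fldr_proposal_def depth sum_A rejection_prob_def by simp
  show "fldr_proposal n A i = real (2 ^ K div m * a i) / 2 ^ K" if "i \<in> {1..n}"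
    using that unfolding fldr_proposal_def depth by (auto simp: A_def)
qed

theorem entropy_optimal_ALDR_iff:
  assumes m_eq: "m = (\<Sum>i=1..n. a i)" and m_pos: "0 < m" and m_le: "m \<le> 2 ^ K"
    and t: "is_ALDR n a K t"
  shows "entropy_optimal (normalized_weights n a) t \<longleftrightarrow>
    (\<forall>i\<in>{1..n}. (1 - digit_fps (rejection_prob m K)) * digit_fps (real (a i) / real m)
       = digit_fps (real (2 ^ K div m * a i) / 2 ^ K))"
proof -
  interpret weights: finite_distribution "{1..n}" "normalized_weights n a"
    using m_eq m_pos by (intro finite_distribution_normalized_weights) simp
  let ?r = "digit_fps (rejection_prob m K)" and ?P = "normalized_weights n a"
  have "0 < 2 ^ K div m * m"
    using m_pos m_le by (simp add: div_greater_zero_iff)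
  then have "0 < (\<Sum>i=1..n. 2 ^ K div m * a i)"
    by (simp only: m_eq sum_distrib_left)
  with t have unrolled: "(1 - ?r) * node_fps (unroll t) (Leaf i)
      = (if i \<in> {1..n} then digit_fps (real (2 ^ K div m * a i) / 2 ^ K) else 0)" for i
    using node_fps_unroll_FLDR[of n "\<lambda>i. 2 ^ K div m * a i" t i]
    unfolding is_ALDR_def m_eq[symmetric]
    by (cases "i \<in> {1..n}") (auto simp: fldr_proposal_ALDR[OF m_eq m_pos m_le])
  have "fps_nth (1 - ?r) 0 = 1"
    using rejection_prob_bounds[OF m_pos m_le] by (simp add: eps_nonpos_index)
  then have "1 - ?r \<noteq> 0" by (metis fps_zero_nth zero_neq_one)
  then have "entropy_optimal ?P t
      \<longleftrightarrow> (\<forall>i. (1 - ?r) * digit_fps (?P i) = (1 - ?r) * node_fps (unroll t) (Leaf i))"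
    unfolding weights.entropy_optimal_iff_digits mult_cancel_left by auto
  also have "\<dots> \<longleftrightarrow> (\<forall>i\<in>{1..n}. (1 - ?r) * digit_fps (real (a i) / real m)
      = digit_fps (real (2 ^ K div m * a i) / 2 ^ K))"
    unfolding unrolled normalized_weights_def m_eq[symmetric] by auto
  finally show ?thesis .
qed

section \<open>The depth of an entropy-optimal ALDR tree\<close>

text \<open>If \<open>f\<close> has a nonzero coefficient at \<open>d\<close>, two terms of \<open>h\<close>, at \<open>j\<close> and \<open>k\<close>, would raise the
  coefficient of \<open>f\<close> at \<open>d + j + k\<close> to at least 2.\<close>

lemma single_term_of_fps_quotient_01:
  fixes f g h :: "int fps"
  assumes quotient: "(1 - h) * f = g" and "f \<noteq> 0"
    and f_bounds: "\<And>d. 0 \<le> fps_nth f d" "\<And>d. fps_nth f d \<le> 1"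
    and g_nonneg: "\<And>d. 0 \<le> fps_nth g d" and h_nonneg: "\<And>d. 0 \<le> fps_nth h d"
    and h_pos: "0 < fps_nth h j" "0 < fps_nth h k"
  shows "j = k"
proof (rule ccontr)
  assume "j \<noteq> k"
  have f_eq: "f = g + h * f"
    using quotient by (simp add: algebra_simps)
  have f_ge: "(\<Sum>i\<in>J. fps_nth h i * fps_nth f (d - i)) \<le> fps_nth f d" if "J \<subseteq> {0..d}" for J d
  proof -
    have "(\<Sum>i\<in>J. fps_nth h i * fps_nth f (d - i)) \<le> fps_nth (h * f) d"
      unfolding fps_mult_nth using that f_bounds(1) h_nonneg by (intro sum_mono2) auto
    also have "\<dots> \<le> fps_nth f d"
      using g_nonneg[of d] by (subst (2) f_eq) simp
    finally show ?thesis .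
  qed
  obtain d where "fps_nth f d \<noteq> 0"
    using \<open>f \<noteq> 0\<close> by (metis fps_ext fps_zero_nth)
  then have "0 < fps_nth f d" using f_bounds(1)[of d] by simp
  then have "0 < fps_nth h j * fps_nth f d" "0 < fps_nth h k * fps_nth f d"
    using h_pos by simp_all
  then have "0 < fps_nth f (d + j)" "0 < fps_nth f (d + k)"
    using f_ge[of "{j}" "d + j"] f_ge[of "{k}" "d + k"] by simp_all
  then have "0 < fps_nth h j * fps_nth f (d + k)" "0 < fps_nth h k * fps_nth f (d + j)"
    using h_pos by simp_all
  moreover have "fps_nth h j * fps_nth f (d + k) + fps_nth h k * fps_nth f (d + j)
      \<le> fps_nth f (d + j + k)"
    using f_ge[of "{j, k}" "d + j + k"] \<open>j \<noteq> k\<close> by (simp add: algebra_simps)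
  ultimately show False
    using f_bounds(2)[of "d + j + k"] by linarith
qed

lemma power2_mod_eq_power2_imp_le:
  fixes x :: nat
  assumes "odd x" and rem: "2 ^ (j + k) mod (2 ^ u * x) = 2 ^ j" and "0 < k"
  shows "u + ord x 2 \<le> j + k"
proof -
  have "2 ^ u * x dvd 2 ^ (j + k) - 2 ^ j"
    using dvd_minus_mod[of "2 ^ u * x" "2 ^ (j + k)"] by (simp only: rem)
  also have "2 ^ (j + k) - 2 ^ j = 2 ^ j * (2 ^ k - 1 :: nat)"
    by (simp add: power_add diff_mult_distrib2)
  finally have dvd: "2 ^ u * x dvd 2 ^ j * (2 ^ k - 1)" .
  have "coprime x (2 ^ j)"
    using \<open>odd x\<close> by simp
  then have "x dvd 2 ^ k - 1"
    using dvd by (metis coprime_dvd_mult_right_iff dvd_mult_right)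
  then have "[2 ^ k = 1] (mod x)"
    by (simp add: cong_altdef_nat cong_sym)
  then have "ord x 2 dvd k"
    by (simp only: ord_divides)
  then have "ord x 2 \<le> k" using \<open>0 < k\<close> by (rule dvd_imp_le)
  moreover have "u \<le> j"
  proof -
    have "coprime (2 ^ u) (2 ^ k - 1 :: nat)"
      using \<open>0 < k\<close> by simp
    then have "2 ^ u dvd (2 ^ j :: nat)"
      using dvd by (metis coprime_dvd_mult_left_iff dvd_mult_left)
    then show ?thesis by (simp add: dvd_power_iff_le)
  qed
  ultimately show ?thesis by simp
qed

lemma power2_mod_pos:
  fixes x :: nat
  assumes "1 < x" "odd x"
  shows "0 < 2 ^ K mod (2 ^ u * x)"
proof (rule ccontr)
  assume "\<not> 0 < 2 ^ K mod (2 ^ u * x)"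
  then have "x dvd 2 ^ K" by (metis dvd_mult_right mod_0_imp_dvd gr0I)
  moreover have "coprime x (2 ^ K)" using assms by simp
  ultimately show False using assms by (metis coprime_absorb_left nat_dvd_1_iff_1 less_irrefl)
qed

lemma depth_ge_of_rejection_prob_eq_inverse_power2:
  assumes m_decomp: "m = 2 ^ u * x" "1 < x" "odd x" and m_le: "m \<le> 2 ^ K"
    and rejection: "rejection_prob m K = 1 / 2 ^ k"
  shows "u + ord x 2 \<le> K"
proof -
  have "real (2 ^ K mod m * 2 ^ k) = real (2 ^ K)"
    using rejection by (simp add: rejection_prob_def field_simps)
  then have rem_mult: "2 ^ K mod m * 2 ^ k = 2 ^ K" by (simp only: of_nat_eq_iff)
  then have "2 ^ K mod m dvd 2 ^ K" by (metis dvd_triv_left)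
  then obtain j where rem_eq: "2 ^ K mod m = 2 ^ j"
    using divides_primepow_nat[OF two_is_prime_nat] by blast
  then have K_eq: "K = j + k"
    using rem_mult by (simp flip: power_add)
  have "rejection_prob m K < 1"
    using m_decomp m_le by (intro rejection_prob_bounds) auto
  then have "0 < k" using rejection by (intro gr0I) simp
  then show ?thesis
    using power2_mod_eq_power2_imp_le[OF m_decomp(3), of j k u] rem_eq
    unfolding K_eq m_decomp(1) by simp
qed

lemma entropy_optimal_ALDR_imp_depth_ge:
  assumes m_eq: "m = (\<Sum>i=1..n. a i)" and m_decomp: "m = 2 ^ u * x" "1 < x" "odd x"
    and m_le: "m \<le> 2 ^ K"
    and t: "is_ALDR n a K t" and optimal: "entropy_optimal (normalized_weights n a) t"
  shows "u + ord x 2 \<le> K"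
proof -
  let ?r = "rejection_prob m K"
  have "0 < m" using m_decomp by simp
  then obtain i where i: "i \<in> {1..n}" "0 < a i"
    unfolding m_eq by (metis sum.neutral neq0_conv)
  have "a i \<le> m" unfolding m_eq using i by (intro member_le_sum) auto
  then have p: "0 < real (a i) / real m" "real (a i) / real m < 2"
    using i \<open>0 < m\<close> by (simp_all add: divide_less_eq)
  have quotient: "(1 - digit_fps ?r) * digit_fps (real (a i) / real m)
      = digit_fps (real (2 ^ K div m * a i) / 2 ^ K)"
    using optimal entropy_optimal_ALDR_iff[OF m_eq \<open>0 < m\<close> m_le t] i by blast
  have "j = k" if "eps (int j) ?r = 1" "eps (int k) ?r = 1" for j k
    by (rule single_term_of_fps_quotient_01[OF quotient digit_fps_nonzero[OF p]])
      (simp_all add: that)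
  moreover have "0 < ?r"
    using power2_mod_pos[OF m_decomp(2,3), of K u] by (simp add: rejection_prob_def m_decomp(1))
  moreover have "?r < 2"
    using rejection_prob_bounds[OF \<open>0 < m\<close> m_le] by simp
  ultimately obtain k where "?r = 1 / 2 ^ k"
    using inverse_power2_of_single_digit[of ?r] by metis
  then show ?thesis
    by (rule depth_ge_of_rejection_prob_eq_inverse_power2[OF m_decomp m_le])
qed

section \<open>ALDR at the period of the binary expansion\<close>

lemma power2_add_ord_mod:
  fixes x :: nat
  assumes "1 < x" "odd x"
  shows "2 ^ (u + ord x 2) mod (2 ^ u * x) = 2 ^ u"
proof -
  have "2 ^ ord x 2 mod x = 1"
    using ord[of 2 x] assms by (simp add: cong_def)
  then show ?thesis by (simp add: power_add mult_mod_right[symmetric])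
qed

lemma le_power2_add_ord:
  fixes x :: nat
  assumes "1 < x" "odd x"
  shows "2 ^ u * x \<le> 2 ^ (u + ord x 2)"
proof (rule ccontr)
  assume "\<not> 2 ^ u * x \<le> 2 ^ (u + ord x 2)"
  then have "2 ^ (u + ord x 2) = (2 :: nat) ^ u"
    using power2_add_ord_mod[OF assms, of u] by simp
  moreover have "0 < ord x 2" using assms by (simp add: ord_eq_0 gr0I)
  ultimately show False by simp
qed

lemma digit_fps_rejection_prob_period:
  assumes "1 < x" "odd x"
  shows "digit_fps (rejection_prob (2 ^ u * x) (u + ord x 2)) = fps_X ^ ord x 2"
  unfolding rejection_prob_def power2_add_ord_mod[OF assms] digit_fps_inverse_power2[symmetric]
  by (simp add: power_add)

lemma ALDR_weight_period:
  assumes "m = 2 ^ u * x" "1 < x" "odd x" "l = ord x 2"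
  shows "real (2 ^ (u + l) div m * b) / 2 ^ (u + l) = real b / real m - real b / real m / 2 ^ l"
proof -
  have "2 ^ (u + l) div m * m + 2 ^ u = 2 ^ (u + l)"
    using div_mult_mod_eq[of "2 ^ (u + l)" m]
    by (simp only: assms power2_add_ord_mod[OF assms(2,3)])
  then have "real (2 ^ (u + l) div m) * real m + 2 ^ u = 2 ^ (u + l)"
    by (metis of_nat_add of_nat_mult of_nat_numeral of_nat_power)
  moreover have "0 < real m" using assms by simp
  ultimately have "real (2 ^ (u + l) div m) = 2 ^ u * (2 ^ l - 1) / real m"
    by (simp add: eq_divide_eq power_add algebra_simps)
  then have "real (2 ^ (u + l) div m * b) / 2 ^ (u + l) = real b / real m * ((2 ^ l - 1) / 2 ^ l)"
    unfolding of_nat_mult by (simp add: power_add)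
  then show ?thesis
    by (simp add: diff_divide_distrib right_diff_distrib)
qed

section \<open>Equivalence of the conditions\<close>

lemma less_sum_of_Gcd_eq_1:
  fixes a :: "'a \<Rightarrow> nat"
  assumes "finite I" "i \<in> I" and pos: "\<And>i. i \<in> I \<Longrightarrow> 0 < a i"
    and "Gcd (a ` I) = 1" "sum a I \<noteq> 1"
  shows "a i < sum a I"
proof (cases "I = {i}")
  case False
  then have "0 < sum a (I - {i})"
    using assms by (intro sum_pos) auto
  then show ?thesis
    using assms(1,2) by (simp add: sum.remove[of I i])
qed (use assms in simp)

theorem theorem5p6:
  fixes n m u x l c :: nat
    and a :: "nat \<Rightarrow> nat"
    and p q P :: "nat \<Rightarrow> real"
    and ALDR :: "nat \<Rightarrow> nat ddg"
  assumes a_pos: "\<And>i. i \<in> {1..n} \<Longrightarrow> 0 < a i"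
    and a_gcd: "Gcd (a ` {1..n}) = 1"
    and m_def: "m = (\<Sum>i=1..n. a i)"
    and m_not_pow2: "\<not> (\<exists>k. m = 2 ^ k)"
    and p_def: "\<And>i. i \<in> {1..n} \<Longrightarrow> p i = real (a i) / real m"
    and P_def: "P = (\<lambda>i. if i \<in> {1..n} then p i else 0)"
    and m_decomp: "m = 2 ^ u * x" "1 < x" "odd x"
    and l_def: "l = ord x 2"
    and c_def: "c = 2 ^ (u + l) div m"
    and q_def: "\<And>i. i \<in> {1..n} \<Longrightarrow> q i = real (c * a i) / 2 ^ (u + l)"
    and ALDR: "\<And>K. \<lceil>log 2 (real m)\<rceil> \<le> int K \<Longrightarrow> is_ALDR n a K (ALDR K)"
  shows "all_equivalent
    [\<exists>K. \<lceil>log 2 (real m)\<rceil> \<le> int K \<and> K \<le> u + l \<and> entropy_optimal P (ALDR K),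
     entropy_optimal P (ALDR (u + l)),
     \<forall>i\<in>{1..n}. (1 - fps_X ^ l) * digit_fps (p i) = digit_fps (q i),
     \<forall>i\<in>{1..n}. \<forall>d. 0 \<le> fps_nth ((1 - fps_X ^ l) * digit_fps (p i)) d,
     \<forall>d\<ge>1. \<forall>i\<in>{1..n}. eps d (p i) \<le> eps (d + int l) (p i)]"
    (is "all_equivalent [?E1, ?E2, ?E3, ?E4, ?E5]")
proof -
  have m_pos: "0 < m" using m_decomp by auto
  have P_eq: "P = normalized_weights n a"
    by (auto simp: P_def p_def normalized_weights_def m_def)
  have "m \<noteq> 1" using m_not_pow2 by (metis power_0)
  then have "a i < m" if "i \<in> {1..n}" for i
    unfolding m_def using that by (intro less_sum_of_Gcd_eq_1 a_pos a_gcd) simp_all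
  then have unit_interval: "0 \<le> p i" "p i < 1" if "i \<in> {1..n}" for i
    using that m_pos by (simp_all add: p_def)
  have q_eq: "q i = p i - p i / 2 ^ l" if "i \<in> {1..n}" for i
    unfolding q_def[OF that] p_def[OF that] c_def by (rule ALDR_weight_period[OF m_decomp l_def])
  have m_le: "m \<le> 2 ^ (u + l)"
    unfolding m_decomp(1) l_def by (rule le_power2_add_ord[OF m_decomp(2,3)])
  note is_ALDR = ALDR[unfolded ceiling_log2_le_iff[OF m_pos]]
  have "?E1 \<longleftrightarrow> ?E2"
    using entropy_optimal_ALDR_imp_depth_ge[OF m_def m_decomp _ is_ALDR] m_le
    unfolding ceiling_log2_le_iff[OF m_pos] P_eq l_def by (metis le_antisym order_refl)
  moreover have "?E2 \<longleftrightarrow> ?E3"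
    using entropy_optimal_ALDR_iff[OF m_def m_pos m_le is_ALDR[OF m_le]]
      digit_fps_rejection_prob_period[OF m_decomp(2,3), of u]
    by (simp add: P_eq p_def q_def c_def flip: m_decomp(1) l_def)
  moreover have "?E3 \<longleftrightarrow> ?E4"
    using period_factor_digit_fps_eq_iff[OF unit_interval] by (simp add: q_eq)
  moreover have "?E4 \<longleftrightarrow> ?E5"
    using period_factor_digit_fps_nonneg_iff[OF unit_interval] eps_le_shift_iff[OF unit_interval]
    by auto
  ultimately show ?thesis by (simp add: all_equivalent_def)
qed

end
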